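(* Let $n$ be a positive integer. Then $$t(1,5,5,5;n)=\sum_{d\mid 8n+16}(-1)^{d}\Big(\Big(\frac 5d\Big)+\Big(\frac 5{(8n+16)/d}\Big)\Big)d-\sum_{d\mid 2n+4}(-1)^{d}\Big(\Big(\frac 5d\Big)+\Big(\frac 5{(2n+4)/d}\Big)\Big)d,$$ where the sums are over positive divisors $d$.
   Context: $\left(\frac{a}{m}\right)$ is the Legendre–Jacobi–Kronecker symbol. For positive integers $a,b,c,d$ and a nonnegative integer $n$, $t(a,b,c,d;n)$ denotes the number of $(x,y,z,w)\in\mathbb Z^4$ with $n=a\frac{x(x-1)}2+b\frac{y(y-1)}2+c\frac{z(z-1)}2+d\frac{w(w-1)}2$. *)

theory Defs
  imports "HOL-Number_Theory.Number_Theory"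
begin

text \<open>
  The Kronecker symbol at a prime. The library's Legendre symbol is the right one for odd
  primes only: it is 1 at the prime 2 for every odd argument.
\<close>

definition kronecker_prime :: "int \<Rightarrow> nat \<Rightarrow> int" where
  "kronecker_prime a p =
     (if p = 2 then
        (if even a then 0 else if a mod 8 = 1 \<or> a mod 8 = 7 then 1 else -1)
      else Legendre a (int p))"

definition kronecker :: "int \<Rightarrow> int \<Rightarrow> int" where
  "kronecker a m =
     (if m = 0 then (if \<bar>a\<bar> = 1 then 1 else 0)
      else (if m < 0 \<and> a < 0 then -1 else 1) *
           (\<Prod>p\<in>prime_factors (nat \<bar>m\<bar>). kronecker_prime a p ^ multiplicity p (nat \<bar>m\<bar>)))"

text \<open>The integer divisions by 2 are exact, as \<open>x * (x - 1)\<close> is even.\<close>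

definition tri_reps ::
    "nat \<Rightarrow> nat \<Rightarrow> nat \<Rightarrow> nat \<Rightarrow> nat \<Rightarrow> (int \<times> int \<times> int \<times> int) set" where
  "tri_reps a b c d n =
     {(x, y, z, w). int n = int a * (x * (x - 1) div 2) + int b * (y * (y - 1) div 2)
                          + int c * (z * (z - 1) div 2) + int d * (w * (w - 1) div 2)}"

definition tri_count :: "nat \<Rightarrow> nat \<Rightarrow> nat \<Rightarrow> nat \<Rightarrow> nat \<Rightarrow> nat" where
  "tri_count a b c d n = card (tri_reps a b c d n)"

lemma triangular_nonneg: "0 \<le> x * (x - 1) div 2" for x :: int
proof -
  have "0 \<le> x * (x - 1)"
    by (cases "x \<ge> 1") (auto intro: mult_nonneg_nonneg mult_nonpos_nonpos)
  then show ?thesis by simp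
qed

lemma triangular_bound:
  fixes x :: int
  assumes "x * (x - 1) div 2 \<le> int n"
  shows "x \<in> {- (2 * int n + 2)..2 * int n + 2}"
proof -
  have *: "x * (x - 1) \<le> 2 * int n + 1" using assms by linarith
  have "x \<le> 2 * int n + 2"
  proof (rule ccontr)
    assume "\<not> ?thesis"
    then have "x \<ge> 2 * int n + 3" by simp
    then have "(2 * int n + 3) * 1 \<le> x * (x - 1)" by (intro mult_mono) auto
    with * show False by simp
  qed
  moreover have "- (2 * int n + 2) \<le> x"
  proof (rule ccontr)
    assume "\<not> ?thesis"
    then have "- x \<ge> 2 * int n + 3" by simp
    then have "(2 * int n + 3) * 1 \<le> (- x) * (1 - x)" by (intro mult_mono) auto
    with * show False by (simp add: algebra_simps)
  qed
  ultimately show ?thesis by simp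
qed

lemma finite_tri_reps:
  assumes "a > 0" "b > 0" "c > 0" "d > 0"
  shows "finite (tri_reps a b c d n)"
proof -
  let ?I = "{- (2 * int n + 2)..2 * int n + 2}"
  have le: "T \<le> int k * T" if "k > 0" "0 \<le> T" for k :: nat and T :: int
    using mult_right_mono[of 1 "int k" T] that by simp
  have "tri_reps a b c d n \<subseteq> ?I \<times> ?I \<times> ?I \<times> ?I"
  proof
    fix v assume "v \<in> tri_reps a b c d n"
    then obtain x y z w where v: "v = (x, y, z, w)"
      and e: "int n = int a * (x * (x - 1) div 2) + int b * (y * (y - 1) div 2)
                    + int c * (z * (z - 1) div 2) + int d * (w * (w - 1) div 2)"
      by (auto simp: tri_reps_def)
    note nn = triangular_nonneg[of x] triangular_nonneg[of y]
      triangular_nonneg[of z] triangular_nonneg[of w]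
    note l = le[OF assms(1) nn(1)] le[OF assms(2) nn(2)] le[OF assms(3) nn(3)] le[OF assms(4) nn(4)]
    have "x \<in> ?I" "y \<in> ?I" "z \<in> ?I" "w \<in> ?I"
      by (rule triangular_bound, use e nn l in linarith)+
    then show "v \<in> ?I \<times> ?I \<times> ?I \<times> ?I" unfolding v by blast
  qed
  then show ?thesis by (rule finite_subset) auto
qed

end

theory Submission
  imports Defs "HOL-Complex_Analysis.Complex_Analysis"
begin

text \<open>
  Write \<open>(x; p)\<close> for the product of all \<open>1 - x p\<^sup>n\<close>, and put \<open>P = (q\<^sup>2; q\<^sup>2)\<close>, \<open>R = (q\<^sup>1\<^sup>0; q\<^sup>1\<^sup>0)\<close>,
  \<open>x = (q; q\<^sup>2)\<close>, \<open>y = (q\<^sup>5; q\<^sup>1\<^sup>0)\<close>. By the triple product, the generating function of the left-hand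
  side is \<open>16 P R\<^sup>3 / (x y\<^sup>3)\<close>. With \<open>\<chi>\<close> the quadratic character modulo 5, the right-hand side equals
  \<open>4 \<Sum> d (\<chi>(m/d) - \<chi>(d))\<close>, summed over the divisors \<open>d\<close> of \<open>m = n + 2\<close> with \<open>m/d\<close> odd. Its generating
  function is four times the difference of the Lambert series
  \<open>B = \<Sum> d \<chi>(e) q\<^sup>d\<^sup>e\<close> and \<open>A = \<Sum> d \<chi>(d) q\<^sup>d\<^sup>e\<close> over \<open>d \<ge> 1\<close> and odd \<open>e\<close>.

  Both are differences of two values of one elliptic function: \<open>B\<close> at the points \<open>q\<close>, \<open>q\<^sup>3\<close> for the
  nome \<open>q\<^sup>1\<^sup>0\<close>, and a multiple of \<open>A\<close> at \<open>\<zeta> q\<close>, \<open>\<zeta>\<^sup>2 q\<close> for the nome \<open>q\<^sup>2\<close>, with \<open>\<zeta>\<close> a fifth root of unity.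
  The factorisation of such differences into theta functions gives \<open>B = q P R\<^sup>3 y\<^sup>2 / x\<^sup>2\<close> and
  \<open>A = q P\<^sup>3 R x\<^sup>2 / y\<^sup>2\<close>. It remains to see that \<open>R\<^sup>2 y\<^sup>4 - P\<^sup>2 x\<^sup>4 = 4 q R\<^sup>2 x / y\<close>, which is Ramanujan's
  identity for \<open>\<phi>(-q\<^sup>5)\<^sup>2 - \<phi>(-q)\<^sup>2\<close>, where \<open>\<phi>(q)\<close> is the sum of all \<open>q\<close> to the power \<open>n\<^sup>2\<close>; it follows
  by sorting the integer points \<open>(u, v)\<close> by \<open>u + 2 v\<close> modulo 5.
\<close>

section \<open>The q-Pochhammer symbol\<close>

text \<open>The infinite symbol (x; p). The nome comes first, so that \<open>qpoch p\<close> is an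
  entire function of \<open>x\<close> for each nome of norm below 1.\<close>

definition qpoch :: "complex \<Rightarrow> complex \<Rightarrow> complex" where
  "qpoch p x = (\<Prod>n. 1 - x * p ^ n)"

lemma convergent_prod_qpoch:
  fixes p x :: complex
  assumes "norm p < 1"
  shows "convergent_prod (\<lambda>n. 1 - x * p ^ n)"
proof (rule abs_convergent_prod_imp_convergent_prod)
  have "summable (\<lambda>n. norm x * norm p ^ n)"
    using assms by (intro summable_mult summable_geometric) auto
  then show "abs_convergent_prod (\<lambda>n. 1 - x * p ^ n)"
    unfolding abs_convergent_prod_conv_summable by (simp add: norm_mult norm_power)
qed

lemma LIMSEQ_qpoch:
  assumes "norm p < 1"
  shows "(\<lambda>n. \<Prod>k<n. 1 - x * p ^ k) \<longlonglongrightarrow> qpoch p x"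
  unfolding qpoch_def
  by (intro has_prod_imp_tendsto' convergent_prod_has_prod convergent_prod_qpoch assms)

lemma qpoch_unfold:
  assumes "norm p < 1"
  shows "qpoch p x = (1 - x) * qpoch p (p * x)"
proof -
  have "(\<lambda>n. \<Prod>k<Suc n. 1 - x * p ^ k) \<longlonglongrightarrow> qpoch p x"
    using LIMSEQ_qpoch[OF assms, of x] by (rule LIMSEQ_Suc)
  moreover have "(\<lambda>n. (1 - x) * (\<Prod>k<n. 1 - (p * x) * p ^ k)) \<longlonglongrightarrow> (1 - x) * qpoch p (p * x)"
    by (intro tendsto_intros LIMSEQ_qpoch assms)
  moreover have "(\<Prod>k<Suc n. 1 - x * p ^ k) = (1 - x) * (\<Prod>k<n. 1 - (p * x) * p ^ k)" for n
    by (subst prod.lessThan_Suc_shift) (simp add: mult_ac)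
  ultimately show ?thesis
    using LIMSEQ_unique by auto
qed

lemma qpoch_nonzero:
  assumes "norm p < 1" "\<And>n. x * p ^ n \<noteq> 1"
  shows "qpoch p x \<noteq> 0"
  unfolding qpoch_def
proof (rule prodinf_nonzero)
  show "1 - x * p ^ i \<noteq> 0" for i
    using assms(2)[of i] by auto
qed (rule convergent_prod_qpoch[OF assms(1)])

lemma qpoch_nonzero_norm:
  assumes "norm p < 1" "norm x < 1"
  shows "qpoch p x \<noteq> 0"
proof (rule qpoch_nonzero[OF assms(1)])
  fix n
  have "norm (x * p ^ n) \<le> norm x * 1"
    using assms by (simp add: norm_mult norm_power power_le_one mult_left_le)
  then show "x * p ^ n \<noteq> 1" using assms by auto
qed

text \<open>On each disc of radius 1 the factors differ from 1 by at most a fixed geometric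
  sequence, so the partial products, which are polynomials, converge locally uniformly.\<close>

lemma holomorphic_qpoch_UNIV:
  assumes "norm p < 1"
  shows "qpoch p holomorphic_on UNIV"
proof (rule holomorphic_uniform_sequence[where f = "\<lambda>n x. \<Prod>k<n. 1 - x * p ^ k"])
  fix x :: complex
  let ?K = "cball x 1"
  have "uniformly_convergent_on ?K (\<lambda>N x. \<Sum>n<N. norm ((1 - x * p ^ n) - 1))"
  proof (rule Weierstrass_m_test'[where M = "\<lambda>n. (norm x + 1) * norm p ^ n"])
    show "norm (norm ((1 - y * p ^ n) - 1)) \<le> (norm x + 1) * norm p ^ n" if "y \<in> ?K" for y n
    proof -
      have "norm y \<le> norm x + 1"
        using that norm_triangle_ineq2[of y x] by (simp add: dist_norm norm_minus_commute)
      then show ?thesis by (simp add: norm_mult norm_power mult_right_mono)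
    qed
    show "summable (\<lambda>n. (norm x + 1) * norm p ^ n)"
      using assms by (intro summable_mult summable_geometric) auto
  qed
  then have "uniformly_convergent_on ?K (\<lambda>N x. \<Prod>n<N. 1 - x * p ^ n)"
    by (intro uniformly_convergent_on_prod') (auto intro!: continuous_intros)
  then obtain l where l: "uniform_limit ?K (\<lambda>N x. \<Prod>n<N. 1 - x * p ^ n) l sequentially"
    by (auto simp: uniformly_convergent_on_def)
  have "l y = qpoch p y" if "y \<in> ?K" for y
    using tendsto_uniform_limitI[OF l that] LIMSEQ_qpoch[OF assms, of y] LIMSEQ_unique by blast
  with l have "uniform_limit ?K (\<lambda>N x. \<Prod>n<N. 1 - x * p ^ n) (qpoch p) sequentially"
    using uniform_limit_cong'[of ?K "\<lambda>N x. \<Prod>n<N. 1 - x * p ^ n" "\<lambda>N x. \<Prod>n<N. 1 - x * p ^ n" l "qpoch p"]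
    by auto
  then show "\<exists>d>0. cball x d \<subseteq> UNIV \<and>
      uniform_limit (cball x d) (\<lambda>n x. \<Prod>k<n. 1 - x * p ^ k) (qpoch p) sequentially"
    by (intro exI[of _ 1]) auto
qed (auto intro!: holomorphic_intros)

lemma holomorphic_qpoch [holomorphic_intros]:
  assumes "norm p < 1" "f holomorphic_on A"
  shows "(\<lambda>x. qpoch p (f x)) holomorphic_on A"
  using holomorphic_on_compose_gen[OF assms(2) holomorphic_qpoch_UNIV[OF assms(1)]]
  by (simp add: o_def)

text \<open>The factors are sorted by the residue of their exponent modulo \<open>k\<close>. For
  partial products with \<open>n * k\<close> factors this is a finite rearrangement; then
  \<open>n\<close> tends to infinity.\<close>

lemma qpoch_split:
  assumes "norm p < 1" "k > 0"
  shows "qpoch p x = (\<Prod>j<k. qpoch (p ^ k) (x * p ^ j))"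
proof -
  have pk: "norm (p ^ k) < 1"
    using assms by (simp add: norm_power power_less_one_iff)
  have "(\<lambda>n. \<Prod>i<n * k. 1 - x * p ^ i) \<longlonglongrightarrow> qpoch p x"
    using LIMSEQ_subseq_LIMSEQ[OF LIMSEQ_qpoch[OF assms(1), of x], of "\<lambda>n. n * k"] assms(2)
    by (simp add: o_def strict_mono_def)
  moreover have "(\<Prod>i<n * k. 1 - x * p ^ i) = (\<Prod>j<k. \<Prod>m<n. 1 - (x * p ^ j) * (p ^ k) ^ m)" for n
  proof -
    have "(\<Prod>i<n * k. 1 - x * p ^ i) = (\<Prod>m<n. \<Prod>i = m * k..<m * k + k. 1 - x * p ^ i)"
      by (simp add: prod.nat_group)
    also have "\<dots> = (\<Prod>m<n. \<Prod>j<k. 1 - (x * p ^ j) * (p ^ k) ^ m)"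
    proof (rule prod.cong[OF refl])
      fix m
      have "(\<Prod>i = m * k..<m * k + k. 1 - x * p ^ i) = (\<Prod>j<k. 1 - x * p ^ (m * k + j))"
        by (rule prod.reindex_bij_witness[of _ "\<lambda>j. m * k + j" "\<lambda>i. i - m * k"]) auto
      then show "(\<Prod>i = m * k..<m * k + k. 1 - x * p ^ i) = (\<Prod>j<k. 1 - (x * p ^ j) * (p ^ k) ^ m)"
        by (simp add: power_add power_mult mult.commute[of m k] mult_ac)
    qed
    also have "\<dots> = (\<Prod>j<k. \<Prod>m<n. 1 - (x * p ^ j) * (p ^ k) ^ m)"
      by (rule prod.swap)
    finally show ?thesis .
  qed
  moreover have "(\<lambda>n. \<Prod>j<k. \<Prod>m<n. 1 - (x * p ^ j) * (p ^ k) ^ m)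
      \<longlonglongrightarrow> (\<Prod>j<k. qpoch (p ^ k) (x * p ^ j))"
    by (intro tendsto_prod LIMSEQ_qpoch pk)
  ultimately show ?thesis
    using LIMSEQ_unique by auto
qed

text \<open>The factorisation of \<open>1 - t ^ k\<close> is applied to every factor, at
  \<open>t = x * p ^ m\<close>. The numbers \<open>w i\<close> will be the square roots or the fifth
  roots of unity.\<close>

lemma qpoch_prod_eq:
  assumes "norm p < 1" "k > 0"
    and factor: "\<And>t. (\<Prod>i\<in>I. 1 - w i * t) = 1 - t ^ k"
  shows "(\<Prod>i\<in>I. qpoch p (w i * x)) = qpoch (p ^ k) (x ^ k)"
proof -
  have pk: "norm (p ^ k) < 1"
    using assms by (simp add: norm_power power_less_one_iff)
  have "(\<lambda>n. \<Prod>i\<in>I. \<Prod>m<n. 1 - w i * x * p ^ m) \<longlonglongrightarrow> (\<Prod>i\<in>I. qpoch p (w i * x))"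
    by (intro tendsto_prod LIMSEQ_qpoch assms)
  moreover have "(\<Prod>i\<in>I. \<Prod>m<n. 1 - w i * x * p ^ m) = (\<Prod>m<n. 1 - x ^ k * (p ^ k) ^ m)" for n
  proof -
    have "(\<Prod>i\<in>I. \<Prod>m<n. 1 - w i * x * p ^ m) = (\<Prod>m<n. \<Prod>i\<in>I. 1 - w i * (x * p ^ m))"
      by (subst prod.swap) (simp add: mult_ac)
    also have "\<dots> = (\<Prod>m<n. 1 - x ^ k * (p ^ k) ^ m)"
      by (simp only: factor power_mult_distrib) (simp add: mult.commute flip: power_mult)
    finally show ?thesis .
  qed
  ultimately show ?thesis
    using LIMSEQ_qpoch[OF pk, of "x ^ k"] LIMSEQ_unique by auto
qed

lemma qpoch_neg_mult:
  assumes "norm p < 1"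
  shows "qpoch p x * qpoch p (- x) = qpoch (p ^ 2) (x ^ 2)"
proof -
  have "(\<Prod>w\<in>{1, - 1}. qpoch p (id w * x)) = qpoch (p ^ 2) (x ^ 2)"
    by (rule qpoch_prod_eq) (auto simp: assms power2_eq_square algebra_simps)
  then show ?thesis by simp
qed

section \<open>Jacobi's triple product\<close>

text \<open>The Gaussian binomial coefficient. The Pascal rule defines it as a polynomial in
  \<open>p\<close>, without division, for every complex \<open>p\<close>.\<close>

fun qbinomial :: "complex \<Rightarrow> nat \<Rightarrow> nat \<Rightarrow> complex" where
  "qbinomial p M 0 = 1"
| "qbinomial p 0 (Suc k) = 0"
| "qbinomial p (Suc M) (Suc k) = p ^ Suc k * qbinomial p M (Suc k) + qbinomial p M k"

lemma qbinomial_eq_0: "k > M \<Longrightarrow> qbinomial p M k = 0"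
  by (induction p M k rule: qbinomial.induct) auto

lemma zero_choose_two [simp]: "0 choose 2 = 0"
  by (simp add: numeral_2_eq_2)

lemma Suc_choose_two: "Suc k choose 2 = (k choose 2) + k"
  by (simp add: numeral_2_eq_2)

text \<open>Cauchy's q-binomial theorem. The factor \<open>1 + y\<close> is split off and the
  induction hypothesis used at \<open>y * p\<close>; comparing coefficients of powers of
  \<open>y\<close> gives the Pascal rule.\<close>

lemma qbinomial_theorem:
  "(\<Prod>i<M. 1 + y * p ^ i) = (\<Sum>k\<le>M. p ^ (k choose 2) * qbinomial p M k * y ^ k)"
proof (induction M arbitrary: y)
  case 0
  then show ?case by (simp add: numeral_2_eq_2)
next
  case (Suc M)
  define c where "c k = p ^ (k choose 2) * qbinomial p M k" for k
  have "(\<Prod>i<Suc M. 1 + y * p ^ i) = (1 + y) * (\<Prod>i<M. 1 + (y * p) * p ^ i)"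
    by (subst prod.lessThan_Suc_shift) (simp add: mult_ac)
  also have "\<dots> = (1 + y) * (\<Sum>k\<le>M. c k * (y * p) ^ k)"
    by (simp add: Suc c_def)
  also have "\<dots> = (\<Sum>k\<le>Suc M. c k * (y * p) ^ k) + (\<Sum>k\<le>M. c k * p ^ k * y ^ Suc k)"
    by (simp add: c_def qbinomial_eq_0 distrib_right sum.distrib sum_distrib_left power_mult_distrib mult_ac)
  also have "\<dots> = 1 + (\<Sum>k\<le>M. c (Suc k) * (y * p) ^ Suc k + c k * p ^ k * y ^ Suc k)"
    by (subst sum.atMost_Suc_shift) (simp add: c_def sum.distrib)
  also have "\<dots> = 1 + (\<Sum>k\<le>M. p ^ (Suc k choose 2) * qbinomial p (Suc M) (Suc k) * y ^ Suc k)"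
    by (intro arg_cong2[of _ _ _ _ "(+)"] sum.cong refl)
      (simp add: c_def Suc_choose_two power_mult_distrib power_add algebra_simps)
  also have "\<dots> = (\<Sum>k\<le>Suc M. p ^ (k choose 2) * qbinomial p (Suc M) k * y ^ k)"
    by (subst sum.atMost_Suc_shift) simp
  finally show ?case .
qed

text \<open>The finite symbol (p; p) with \<open>n\<close> factors, a q-factorial not normalised by
  powers of \<open>1 - p\<close>.\<close>

definition qfact :: "complex \<Rightarrow> nat \<Rightarrow> complex" where
  "qfact p n = (\<Prod>i<n. 1 - p * p ^ i)"

lemma qfact_nonzero: "norm p < 1 \<Longrightarrow> qfact p n \<noteq> 0"
  unfolding qfact_def
proof (subst prod_zero_iff)
  assume "norm p < 1"
  have "p * p ^ i \<noteq> 1" for i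
  proof
    assume "p * p ^ i = 1"
    then have "norm (p ^ Suc i) = 1" by simp
    then have "norm p ^ Suc i = 1" by (simp only: norm_power)
    moreover have "norm p ^ Suc i < 1"
      using \<open>norm p < 1\<close> by (subst power_less_one_iff) auto
    ultimately show False by simp
  qed
  then show "\<not> (\<exists>i\<in>{..<n}. 1 - p * p ^ i = 0)" by auto
qed auto

text \<open>The quotient formula for Gaussian binomials, free of division. With
  \<open>M = Suc k + j\<close> the induction step rests on 1 - p^(a+b) = p^a (1 - p^b) + (1 - p^a)
  for a = k + 1, b = j + 1.\<close>

lemma qbinomial_qfact:
  "k \<le> M \<Longrightarrow> qbinomial p M k * (qfact p k * qfact p (M - k)) = qfact p M"
proof (induction p M k rule: qbinomial.induct)
  case (3 p M k)
  have Q: "qfact p (Suc m) = (1 - p ^ Suc m) * qfact p m" for m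
    by (simp add: qfact_def)
  show ?case
  proof (cases "k = M")
    case True
    then have "qbinomial p M k * qfact p k = qfact p M"
      using 3(2) by (simp add: qfact_def)
    then show ?thesis
      using True by (simp add: qbinomial_eq_0 Q qfact_def[of _ 0])
  next
    case False
    then have kM: "Suc k \<le> M" "k \<le> M" using 3(3) by auto
    then obtain j where j: "M = Suc k + j" using nat_le_iff_add by blast
    have 1: "qbinomial p M (Suc k) * ((1 - p ^ Suc k) * qfact p k * qfact p j) = qfact p M"
      using 3(1)[OF kM(1)] by (simp add: Q j)
    have 2: "qbinomial p M k * (qfact p k * ((1 - p ^ Suc j) * qfact p j)) = qfact p M"
      using 3(2)[OF kM(2)] by (simp add: Q j)
    have "qbinomial p (Suc M) (Suc k) * (qfact p (Suc k) * qfact p (Suc M - Suc k)) =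
       p ^ Suc k * (1 - p ^ Suc j) * (qbinomial p M (Suc k) * ((1 - p ^ Suc k) * qfact p k * qfact p j))
       + (1 - p ^ Suc k) * (qbinomial p M k * (qfact p k * ((1 - p ^ Suc j) * qfact p j)))"
      by (simp add: j Q algebra_simps del: power_Suc)
    also have "\<dots> = (1 - p ^ (Suc k + Suc j)) * qfact p M"
      unfolding 1 2 by (simp add: power_add algebra_simps)
    also have "\<dots> = qfact p (Suc M)"
      by (simp add: Q j)
    finally show ?thesis .
  qed
qed (auto simp: qfact_def)

lemma choose_two_int: "int (k choose 2) * 2 = int k * (int k - 1)"
  by (induction k) (auto simp: Suc_choose_two algebra_simps)

text \<open>The q-binomial theorem with \<open>2 * N\<close> factors at \<open>y / p ^ N\<close>:
  the upper half of the factors is the first product, the lower half in reverse order is the second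
  up to a monomial, and the summation index is shifted by \<open>N\<close>.\<close>

lemma finite_triple_product:
  assumes "p \<noteq> 0" "y \<noteq> 0"
  shows "(\<Prod>i<N. 1 + y * p ^ i) * (\<Prod>i<N. 1 + p / y * p ^ i) =
    (\<Sum>n = - int N..int N. qbinomial p (2 * N) (nat (n + int N)) * (y powi n * p powi (n * (n - 1) div 2)))"
proof -
  \<comment> \<open>In reverse order the factors are 1 + y / p^(i+1) = (y / p^(i+1)) (1 + (p / y)
    p^i); the exponents i + 1 add up to \<open>Suc N choose 2\<close>.\<close>
  have rev: "(\<Prod>i<N. 1 + y / p ^ N * p ^ i) * p ^ (Suc N choose 2) = y ^ N * (\<Prod>i<N. 1 + p / y * p ^ i)"
  proof -
    have "(\<Prod>i<N. 1 + y / p ^ N * p ^ i) = (\<Prod>i<N. 1 + y / p ^ Suc i)"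
    proof (rule prod.reindex_bij_witness[of _ "\<lambda>i. N - Suc i" "\<lambda>i. N - Suc i"])
      fix i assume "i \<in> {..<N}"
      then obtain j where j: "N = Suc i + j" using nat_le_iff_add by (metis Suc_leI lessThan_iff)
      show "1 + y / p ^ Suc (N - Suc i) = 1 + y / p ^ N * p ^ i"
        using assms by (simp add: j power_add)
    qed auto
    moreover have "p ^ (Suc N choose 2) = (\<Prod>i<N. p ^ Suc i)"
      by (induction N) (auto simp: Suc_choose_two power_add numeral_2_eq_2 algebra_simps)
    moreover have "(\<Prod>i<N. 1 + y / p ^ Suc i) * (\<Prod>i<N. p ^ Suc i) = (\<Prod>i<N. y * (1 + p / y * p ^ i))"
      unfolding prod.distrib[symmetric]
      using assms by (intro prod.cong refl) (simp add: field_simps)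
    ultimately show ?thesis by (simp add: prod.distrib)
  qed
  have "(\<Prod>i<2 * N. 1 + y / p ^ N * p ^ i) =
      (\<Prod>i<N. 1 + y / p ^ N * p ^ i) * (\<Prod>i<N. 1 + y / p ^ N * p ^ (i + N))"
    using prod.nat_group[of "\<lambda>i. 1 + y / p ^ N * p ^ i" N 2]
    by (simp add: mult.commute[of 2] numeral_2_eq_2 atLeast0LessThan prod.shift_bounds_nat_ivl[of _ 0 N N, simplified])
  also have "(\<Prod>i<N. 1 + y / p ^ N * p ^ (i + N)) = (\<Prod>i<N. 1 + y * p ^ i)"
    using assms by (simp add: power_add)
  finally have split: "(\<Prod>i<2 * N. 1 + y / p ^ N * p ^ i) =
      (\<Prod>i<N. 1 + y / p ^ N * p ^ i) * (\<Prod>i<N. 1 + y * p ^ i)" .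
  have "y ^ N * ((\<Prod>i<N. 1 + y * p ^ i) * (\<Prod>i<N. 1 + p / y * p ^ i)) =
      p ^ (Suc N choose 2) * (\<Prod>i<2 * N. 1 + y / p ^ N * p ^ i)"
    unfolding split using rev by (simp add: mult_ac)
  also have "\<dots> = p ^ (Suc N choose 2) *
      (\<Sum>k\<le>2 * N. p ^ (k choose 2) * qbinomial p (2 * N) k * (y / p ^ N) ^ k)"
    by (simp only: qbinomial_theorem)
  also have "\<dots> = y ^ N * (\<Sum>k\<le>2 * N. qbinomial p (2 * N) k *
      (y powi (int k - int N) * p powi ((int k - int N) * (int k - int N - 1) div 2)))"
    unfolding sum_distrib_left
  proof (rule sum.cong[OF refl])
    fix k
    \<comment> \<open>The powers of \<open>p\<close> from the prefactor, the q-binomial theorem and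
      \<open>(y / p ^ N) ^ k\<close> combine to the exponent belonging to the shifted index
      \<open>k - N\<close>.\<close>
    have "2 * (int (Suc N choose 2) + int (k choose 2) - int (N * k)) = (int k - int N) * (int k - int N - 1)"
      using choose_two_int[of k] choose_two_int[of "Suc N"] by (simp add: algebra_simps)
    then have e: "(int k - int N) * (int k - int N - 1) div 2 = int (Suc N choose 2) + int (k choose 2) - int (N * k)"
      by (metis nonzero_mult_div_cancel_left zero_neq_numeral)
    have "p powi ((int k - int N) * (int k - int N - 1) div 2) =
        p ^ (Suc N choose 2) * p ^ (k choose 2) / p ^ (N * k)"
      unfolding e using assms
      by (subst power_int_diff, simp, subst power_int_add, simp, simp only: power_int_of_nat)
    moreover have "y ^ N * y powi (int k - int N) = y ^ k"
      using assms by (simp add: power_int_diff)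
    ultimately show "p ^ (Suc N choose 2) * (p ^ (k choose 2) * qbinomial p (2 * N) k * (y / p ^ N) ^ k) =
      y ^ N * (qbinomial p (2 * N) k *
      (y powi (int k - int N) * p powi ((int k - int N) * (int k - int N - 1) div 2)))"
      by (simp add: power_divide power_mult mult_ac)
  qed
  also have "(\<Sum>k\<le>2 * N. qbinomial p (2 * N) k *
      (y powi (int k - int N) * p powi ((int k - int N) * (int k - int N - 1) div 2))) =
    (\<Sum>n = - int N..int N. qbinomial p (2 * N) (nat (n + int N)) * (y powi n * p powi (n * (n - 1) div 2)))"
    by (rule sum.reindex_bij_witness[of _ "\<lambda>n. nat (n + int N)" "\<lambda>k. int k - int N"]) auto
  finally show ?thesis using assms by simp
qed

text \<open>Ratio test: consecutive terms have the quotient y p^n, which tends to 0.\<close>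

lemma summable_theta_nat:
  fixes p y :: complex
  assumes "norm p < 1"
  shows "summable (\<lambda>k. norm (y ^ k * p ^ (k choose 2)))"
proof -
  have "(\<lambda>n. norm y * norm p ^ n) \<longlonglongrightarrow> norm y * 0"
    using assms by (intro tendsto_intros LIMSEQ_realpow_zero) auto
  then have "\<forall>\<^sub>F n in sequentially. norm y * norm p ^ n < 1 / 2"
    by (rule order_tendstoD) auto
  then obtain N where N: "\<And>n. n \<ge> N \<Longrightarrow> norm y * norm p ^ n < 1 / 2"
    by (auto simp: eventually_sequentially)
  show ?thesis
  proof (rule summable_ratio_test[of "1/2" N])
    fix n assume "n \<ge> N"
    have "norm (norm (y ^ Suc n * p ^ (Suc n choose 2))) =
        (norm y * norm p ^ n) * norm (y ^ n * p ^ (n choose 2))"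
      by (simp add: Suc_choose_two power_add norm_mult norm_power mult_ac)
    also have "\<dots> \<le> 1 / 2 * norm (y ^ n * p ^ (n choose 2))"
      using N[OF \<open>n \<ge> N\<close>] by (intro mult_right_mono) auto
    finally show "norm (norm (y ^ Suc n * p ^ (Suc n choose 2))) \<le>
        1 / 2 * norm (norm (y ^ n * p ^ (n choose 2)))" by simp
  qed auto
qed

lemma theta_term_nonneg:
  "y powi int k * p powi (int k * (int k - 1) div 2) = y ^ k * p ^ (k choose 2)"
proof -
  have "int k * (int k - 1) div 2 = int (k choose 2)"
    using choose_two_int[of k] by linarith
  then show ?thesis by simp
qed

text \<open>Reflecting the index exchanges \<open>y\<close> and \<open>p / y\<close>, so the
  negative half of the bilateral series is again a series of the one-sided kind.\<close>

lemma theta_term_nonpos: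
  fixes p y :: complex
  assumes "p \<noteq> 0"
  shows "y powi (- int k) * p powi (- int k * (- int k - 1) div 2) = (p / y) ^ k * p ^ (k choose 2)"
proof -
  have "- int k * (- int k - 1) div 2 = int (Suc k choose 2)"
    using choose_two_int[of "Suc k"] by (simp add: algebra_simps)
  then have "p powi (- int k * (- int k - 1) div 2) = p ^ (Suc k choose 2)"
    by (simp only: power_int_of_nat)
  then show ?thesis
    unfolding \<open>- int k * (- int k - 1) div 2 = int (Suc k choose 2)\<close>
    by (simp add: Suc_choose_two power_add power_int_minus power_divide inverse_eq_divide)
qed

lemma abs_summable_theta:
  fixes p y :: complex
  assumes "norm p < 1" "p \<noteq> 0"
  shows "(\<lambda>n::int. norm (y powi n * p powi (n * (n - 1) div 2))) summable_on UNIV"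
proof -
  let ?f = "\<lambda>n::int. norm (y powi n * p powi (n * (n - 1) div 2))"
  have "?f summable_on (range int)"
    unfolding summable_on_reindex[OF inj_on_of_nat] o_def theta_term_nonneg
    by (intro summable_nonneg_imp_summable_on summable_theta_nat assms) auto
  moreover have "?f summable_on (range (\<lambda>k. - int k))"
  proof -
    have inj: "inj (\<lambda>k. - int k)" by (auto simp: inj_on_def)
    show ?thesis
      unfolding summable_on_reindex[OF inj] o_def theta_term_nonpos[OF assms(2)]
      by (intro summable_nonneg_imp_summable_on summable_theta_nat assms) auto
  qed
  ultimately have "?f summable_on (range int \<union> range (\<lambda>k. - int k))"
    by (rule summable_on_union)
  also have "range int \<union> range (\<lambda>k. - int k) = UNIV"
    by (auto intro: int_cases2)
  finally show ?thesis .
qed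

text \<open>Lebesgue's theorem for the counting measure, translated from integrals to
  \<open>has_sum\<close>.\<close>

lemma has_sum_dominated_convergence:
  fixes f :: "nat \<Rightarrow> 'a \<Rightarrow> complex"
  assumes lim: "\<And>x. (\<lambda>N. f N x) \<longlonglongrightarrow> g x"
    and bound: "\<And>N x. norm (f N x) \<le> h x"
    and "h summable_on UNIV"
    and s: "\<And>N. (f N has_sum s N) UNIV" and "s \<longlonglongrightarrow> S"
  shows "(g has_sum S) UNIV"
proof -
  have h: "h x \<ge> 0" for x
    using bound[of 0 x] norm_ge_zero order_trans by blast
  have g: "norm (g x) \<le> h x" for x
    by (rule Lim_norm_ubound[OF _ lim]) (auto simp: bound)
  have abs: "(\<lambda>x. norm (u x)) summable_on UNIV" if "\<And>x. norm (u x) \<le> h x" for u :: "'a \<Rightarrow> complex"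
    by (rule Infinite_Sum.abs_summable_on_comparison_test[of h]) (use assms(3) h that in auto)
  have int: "integrable (count_space UNIV) u" if "(\<lambda>x. norm (u x)) summable_on UNIV"
    for u :: "'a \<Rightarrow> 'b :: {banach, second_countable_topology}"
    using that abs_summable_equivalent[of u UNIV] by (simp add: abs_summable_on_def)
  have int_h: "integrable (count_space UNIV) h"
    using int[of h] assms(3) h by simp
  have eq: "integral\<^sup>L (count_space UNIV) u = infsum u UNIV" if "\<And>x. norm (u x) \<le> h x"
    for u :: "'a \<Rightarrow> complex"
    using infsetsum_infsum[of u UNIV] int[OF abs[OF that]]
    by (simp add: infsetsum_def abs_summable_on_def)
  have "(\<lambda>N. integral\<^sup>L (count_space UNIV) (f N)) \<longlonglongrightarrow> integral\<^sup>L (count_space UNIV) g"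
    by (rule integral_dominated_convergence[where w = h]) (use int_h lim bound in auto)
  then have "(\<lambda>N. infsum (f N) UNIV) \<longlonglongrightarrow> infsum g UNIV"
    using eq g bound by simp
  moreover have "infsum (f N) UNIV = s N" for N
    using s by (rule infsumI)
  ultimately have "infsum g UNIV = S"
    using \<open>s \<longlonglongrightarrow> S\<close> LIMSEQ_unique by auto
  moreover have "g summable_on UNIV"
    using abs[OF g] by (rule abs_summable_summable)
  ultimately show ?thesis by (simp add: has_sum_iff)
qed

text \<open>The limit of \<open>finite_triple_product\<close> as \<open>N\<close> grows: every
  Gaussian binomial tends to \<open>inverse (qpoch p p)\<close>, and dominated convergence allows
  the limit to be taken termwise.\<close>

theorem jacobi_triple_product:
  assumes "norm p < 1" "p \<noteq> 0" "y \<noteq> 0"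
  shows "((\<lambda>n::int. y powi n * p powi (n * (n - 1) div 2)) has_sum
           (qpoch p p * qpoch p (- y) * qpoch p (- (p / y)))) UNIV"
proof -
  let ?t = "\<lambda>n::int. y powi n * p powi (n * (n - 1) div 2)"
  let ?Q = "qpoch p p"
  define f where "f N n = (if n \<in> {- int N..int N}
      then qbinomial p (2 * N) (nat (n + int N)) * ?t n else 0)" for N n
  have Q0: "?Q \<noteq> 0" using assms by (intro qpoch_nonzero_norm)
  have Q: "(\<lambda>n. qfact p n) \<longlonglongrightarrow> ?Q"
    unfolding qfact_def by (rule LIMSEQ_qpoch[OF assms(1)])
  then obtain K where K: "\<And>n. norm (qfact p n) \<le> K"
    by (meson Bseq_def convergentI convergent_imp_Bseq)
  have "(\<lambda>n. inverse (qfact p n)) \<longlonglongrightarrow> inverse ?Q"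
    by (intro tendsto_intros Q Q0)
  then obtain K' where K': "\<And>n. norm (inverse (qfact p n)) \<le> K'"
    by (meson Bseq_def convergentI convergent_imp_Bseq)
  have nonneg: "K \<ge> 0" "K' \<ge> 0"
    using K[of 0] K'[of 0] norm_ge_zero order_trans by blast+
  have closed: "qbinomial p M k = qfact p M * inverse (qfact p k) * inverse (qfact p (M - k))" if "k \<le> M" for k M
    using qbinomial_qfact[OF that, of p] qfact_nonzero[OF assms(1)] by (simp add: field_simps)
  \<comment> \<open>\<open>qfact p n\<close> converges to a nonzero limit, so both it and its
    inverse are bounded; this bounds all Gaussian binomials uniformly.\<close>
  have bound: "norm (f N n) \<le> K * K' * K' * norm (?t n)" for N n
  proof (cases "n \<in> {- int N..int N}")
    case True
    then have "norm (qbinomial p (2 * N) (nat (n + int N))) \<le> K * K' * K'"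
      by (subst closed) (auto simp: norm_mult intro!: mult_mono K K' nonneg mult_nonneg_nonneg)
    then have "norm (qbinomial p (2 * N) (nat (n + int N))) * norm (?t n) \<le> K * K' * K' * norm (?t n)"
      by (rule mult_right_mono) simp
    then show ?thesis using True by (simp add: f_def norm_mult)
  qed (auto simp: f_def nonneg)
  have lim: "(\<lambda>N. f N n) \<longlonglongrightarrow> inverse ?Q * ?t n" for n
  proof -
    have *: "filterlim (\<lambda>N. 2 * N) sequentially sequentially"
      "filterlim (\<lambda>N. nat (n + int N)) sequentially sequentially"
      "filterlim (\<lambda>N. 2 * N - nat (n + int N)) sequentially sequentially"
    proof -
      show "filterlim (\<lambda>N. 2 * N) sequentially sequentially"
        by (rule filterlim_subseq) (auto simp: strict_mono_def)
      show "filterlim (\<lambda>N. nat (n + int N)) sequentially sequentially"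
        unfolding filterlim_at_top eventually_sequentially
        by (intro allI, rule_tac x = "Z + nat \<bar>n\<bar>" in exI) auto
      show "filterlim (\<lambda>N. 2 * N - nat (n + int N)) sequentially sequentially"
        unfolding filterlim_at_top eventually_sequentially
        by (intro allI, rule_tac x = "Z + nat \<bar>n\<bar>" in exI) auto
    qed
    have "(\<lambda>N. qfact p (2 * N) * inverse (qfact p (nat (n + int N))) *
        inverse (qfact p (2 * N - nat (n + int N))) * ?t n) \<longlonglongrightarrow> ?Q * inverse ?Q * inverse ?Q * ?t n"
      by (intro tendsto_intros Q0 filterlim_compose[OF Q] *)
    moreover have "\<forall>\<^sub>F N in sequentially. f N n = qfact p (2 * N) * inverse (qfact p (nat (n + int N))) *
        inverse (qfact p (2 * N - nat (n + int N))) * ?t n"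
      unfolding eventually_sequentially f_def
      by (rule exI[of _ "nat \<bar>n\<bar>"]) (auto simp: closed)
    ultimately show ?thesis
      using Q0 by (simp add: tendsto_cong)
  qed
  have fs: "(f N has_sum (\<Prod>i<N. 1 + y * p ^ i) * (\<Prod>i<N. 1 + p / y * p ^ i)) UNIV" for N
  proof -
    have "(f N has_sum (\<Sum>n = - int N..int N. f N n)) {- int N..int N}"
      by (rule has_sum_finite) auto
    also have "?this \<longleftrightarrow> (f N has_sum (\<Sum>n = - int N..int N. f N n)) UNIV"
      by (rule has_sum_cong_neutral) (auto simp: f_def)
    finally show ?thesis
      unfolding finite_triple_product[OF assms(2,3)] by (simp add: f_def)
  qed
  have "(\<lambda>N. (\<Prod>i<N. 1 - - y * p ^ i) * (\<Prod>i<N. 1 - - (p / y) * p ^ i))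
     \<longlonglongrightarrow> qpoch p (- y) * qpoch p (- (p / y))"
    by (intro tendsto_mult LIMSEQ_qpoch assms)
  then have L: "(\<lambda>N. (\<Prod>i<N. 1 + y * p ^ i) * (\<Prod>i<N. 1 + p / y * p ^ i))
     \<longlonglongrightarrow> qpoch p (- y) * qpoch p (- (p / y))"
    by simp
  have "((\<lambda>n. inverse ?Q * ?t n) has_sum qpoch p (- y) * qpoch p (- (p / y))) UNIV"
    by (rule has_sum_dominated_convergence[OF lim bound _ fs L])
      (intro summable_on_cmult_right abs_summable_theta assms)
  from has_sum_cmult_right[OF this, of ?Q] show ?thesis
    using Q0 by (simp add: mult.assoc[symmetric])
qed

section \<open>Theta functions and Lambert series\<close>

text \<open>Multiplied by \<open>qpoch p p\<close>, this is the bilateral series of the triple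
  product at \<open>- x\<close>.\<close>

definition theta :: "complex \<Rightarrow> complex \<Rightarrow> complex" where
  "theta p x = qpoch p x * qpoch p (p / x)"

text \<open>Isolates the zero at 1. The cofactor is symmetric under inversion of \<open>x\<close>
  and has no zero in the annulus used below.\<close>

lemma theta_alt:
  assumes "norm p < 1"
  shows "theta p x = (1 - x) * (qpoch p (p * x) * qpoch p (p / x))"
  using qpoch_unfold[OF assms, of x] by (simp add: theta_def)

lemma theta_1 [simp]: "norm p < 1 \<Longrightarrow> theta p 1 = 0"
  by (simp add: theta_alt)

lemma theta_inverse:
  assumes "norm p < 1" "x \<noteq> 0"
  shows "theta p (1 / x) = - theta p x / x"
proof -
  have "theta p (1 / x) = (1 - 1 / x) * (qpoch p (p / x) * qpoch p (p * x))"
    using theta_alt[OF assms(1), of "1 / x"] by simp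
  then show ?thesis
    using assms by (simp add: theta_alt field_simps)
qed

lemma theta_mult_nome:
  assumes "norm p < 1" "p \<noteq> 0" "x \<noteq> 0"
  shows "theta p (p * x) = - theta p x / x"
proof -
  have "theta p (p * x) = theta p (1 / x)"
    using assms by (simp add: theta_def mult.commute)
  with theta_inverse[OF assms(1,3)] show ?thesis by simp
qed

text \<open>For a nonzero nome of norm below 1, this region is symmetric under inversion, and 1 is
  the only power of \<open>p\<close> in it, hence the only possible pole below.\<close>

abbreviation nome_annulus :: "complex \<Rightarrow> complex set" where
  "nome_annulus p \<equiv> {x. norm p < norm x \<and> norm x < 1 / norm p}"

lemma open_nome_annulus: "open (nome_annulus p)"
  by (intro open_Collect_conj open_Collect_less continuous_intros)

lemma inverse_in_nome_annulus:
  assumes "p \<noteq> 0" "x \<in> nome_annulus p"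
  shows "1 / x \<in> nome_annulus p"
proof -
  have "x \<noteq> 0" using assms by auto
  with assms show ?thesis by (simp add: norm_divide field_simps)
qed

text \<open>A function that is periodic under multiplication by the nome attains its maximum modulus.\<close>

lemma nome_periodic_imp_constant:
  assumes p: "norm p < 1" "p \<noteq> 0"
    and hol: "f holomorphic_on nome_annulus p"
    and per: "\<And>x. 1 < norm x \<Longrightarrow> norm x < 1 / norm p \<Longrightarrow> f (p * x) = f x"
  shows "f constant_on nome_annulus p"
proof -
  \<comment> \<open>The radii \<open>r\<close> and \<open>1 / r\<close> have quotient
    \<open>norm p\<close>. So \<open>K\<close> is a compact fundamental annulus: one multiplication
    or division by \<open>p\<close> moves any other point of the open annulus into it, and a maximum
    over \<open>K\<close> is a maximum over everything.\<close>
  define r where "r = sqrt (norm p)"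
  have r: "0 < r" "r < 1" "r * r = norm p" using p by (auto simp: r_def)
  have r': "norm p < r" "1 / r < 1 / norm p" "1 < 1 / r"
    using r mult_strict_left_mono[of r 1 r] p
    by (auto intro!: divide_strict_left_mono)
  define K :: "complex set" where "K = {x. r \<le> norm x \<and> norm x \<le> 1 / r}"
  have K: "K \<subseteq> nome_annulus p" using r' by (auto simp: K_def)
  have "closed K"
    unfolding K_def by (intro closed_Collect_conj closed_Collect_le continuous_intros)
  moreover have "bounded K" unfolding bounded_iff K_def by blast
  ultimately have "compact K" by (simp add: compact_eq_bounded_closed)
  moreover have "1 \<in> K" using r r' by (simp add: K_def)
  moreover have "continuous_on K (\<lambda>x. norm (f x))"
    using holomorphic_on_imp_continuous_on[OF hol] K by (intro continuous_on_norm) (rule continuous_on_subset)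
  ultimately obtain \<xi> where \<xi>: "\<xi> \<in> K" "\<And>x. x \<in> K \<Longrightarrow> norm (f x) \<le> norm (f \<xi>)"
    using continuous_attains_sup[of K "\<lambda>x. norm (f x)"] by auto
  have "norm (f x) \<le> norm (f \<xi>)" if x: "x \<in> nome_annulus p" for x
  proof -
    consider "x \<in> K" | "1 / r < norm x" | "norm x < r" by (force simp: K_def)
    then show ?thesis
    proof cases
      case 2
      have "r < norm (p * x)"
        using 2 r by (simp add: norm_mult r(3)[symmetric] field_simps)
      moreover have "norm (p * x) < 1" using x p by (simp add: norm_mult field_simps)
      ultimately have "p * x \<in> K" using r' by (auto simp: K_def)
      moreover have "f (p * x) = f x" using 2 r' x by (intro per) auto
      ultimately show ?thesis using \<xi>(2)[of "p * x"] by simp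
    next
      case 3
      have "norm (x / p) < 1 / r"
        using 3 r p by (simp add: norm_divide r(3)[symmetric] field_simps)
      moreover have "1 < norm (x / p)" using x p by (simp add: norm_divide field_simps)
      ultimately have "x / p \<in> K" using r by (auto simp: K_def)
      moreover have "f (p * (x / p)) = f (x / p)"
        using \<open>1 < norm (x / p)\<close> \<open>norm (x / p) < 1 / r\<close> r' by (intro per) auto
      ultimately show ?thesis using \<xi>(2)[of "x / p"] p by simp
    qed (use \<xi> in auto)
  qed
  moreover have "connected (nome_annulus p)"
    using connected_annulus(1)[of "norm p" "0::complex" "1 / norm p"] by simp
  ultimately show ?thesis
    using \<xi>(1) K by (intro maximum_modulus_principle[OF hol open_nome_annulus _ open_nome_annulus]) auto
qed

section \<open>Lambert series and the Weierstrass function in multiplicative form\<close>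

definition lambert :: "complex \<Rightarrow> complex \<Rightarrow> complex" where
  "lambert p x = (\<Sum>d. of_nat d * p ^ d / (1 - p ^ d) * x ^ d)"

lemma sums_koebe:
  fixes x :: complex
  assumes "norm x < 1"
  shows "(\<lambda>d. of_nat d * x ^ d) sums (x / (1 - x)^2)"
proof -
  have "(\<lambda>n. x * (of_nat (Suc n) * x ^ n)) sums (x * (1 / (1 - x)^2))"
    by (intro sums_mult geometric_deriv_sums assms)
  then have "(\<lambda>n. of_nat (Suc n) * x ^ Suc n) sums (x / (1 - x)^2)"
    by (simp add: mult_ac)
  then show ?thesis by (subst (asm) sums_Suc_iff) simp
qed

lemma norm_one_minus_power_ge:
  fixes p :: complex
  assumes "norm p < 1" "d > 0"
  shows "norm (1 - p ^ d) \<ge> 1 - norm p"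
proof -
  have "norm p ^ d \<le> norm p ^ 1"
    using assms by (intro power_decreasing) auto
  then have "1 - norm p \<le> norm (1::complex) - norm (p ^ d)" by (simp add: norm_power)
  also have "\<dots> \<le> norm (1 - p ^ d)" by (rule norm_triangle_ineq2)
  finally show ?thesis .
qed

text \<open>For \<open>d > 0\<close> the denominators stay away from 0 by \<open>1 - norm p\<close>,
  so the terms are dominated by a multiple of \<open>d * norm (p * x) ^ d\<close>. At
  \<open>d = 0\<close> the denominator is 0 and the term is 0.\<close>

lemma sums_lambert:
  assumes "norm p < 1" "norm (p * x) < 1"
  shows "(\<lambda>d. of_nat d * p ^ d / (1 - p ^ d) * x ^ d) sums lambert p x"
  unfolding lambert_def
proof (rule summable_sums, rule summable_comparison_test')
  show "summable (\<lambda>d. 1 / (1 - norm p) * (of_nat d * norm (p * x) ^ d))"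
  proof (intro summable_mult)
    have "(\<lambda>d. of_nat d * complex_of_real (norm (p * x)) ^ d) sums
      (complex_of_real (norm (p * x)) / (1 - complex_of_real (norm (p * x)))^2)"
      using assms by (intro sums_koebe) auto
    then have "summable (\<lambda>d. complex_of_real (of_nat d * norm (p * x) ^ d))"
      by (simp add: sums_iff)
    then show "summable (\<lambda>d. of_nat d * norm (p * x) ^ d)"
      by (simp only: summable_of_real_iff)
  qed
  show "norm (of_nat d * p ^ d / (1 - p ^ d) * x ^ d) \<le> 1 / (1 - norm p) * (of_nat d * norm (p * x) ^ d)" for d
  proof (cases "d = 0")
    case False
    have "norm (of_nat d * p ^ d / (1 - p ^ d) * x ^ d) = (of_nat d * norm (p * x) ^ d) / norm (1 - p ^ d)"
      by (simp add: norm_mult norm_divide norm_power power_mult_distrib)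
    also have "\<dots> \<le> (of_nat d * norm (p * x) ^ d) / (1 - norm p)"
    proof (rule divide_left_mono)
      show "1 - norm p \<le> norm (1 - p ^ d)"
        using norm_one_minus_power_ge[OF assms(1), of d] False by simp
      then show "0 < norm (1 - p ^ d) * (1 - norm p)"
        using assms(1) by (intro mult_pos_pos) linarith+
    qed auto
    finally show ?thesis by simp
  qed auto
qed

text \<open>Termwise, p^d / (1 - p^d) = p^d p^d / (1 - p^d) + p^d; the last summand yields the
  series of x / (1 - x)^2 at \<open>p * x\<close>.\<close>

lemma lambert_shift:
  assumes "norm p < 1" "norm (p * x) < 1"
  shows "lambert p x = lambert p (p * x) + p * x / (1 - p * x)^2"
proof -
  have px: "norm (p * (p * x)) < 1"
    using mult_mono[of "norm p" 1 "norm (p * x)" "norm (p * x)"] assms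
    by (auto simp: norm_mult)
  have "(\<lambda>d. of_nat d * p ^ d / (1 - p ^ d) * (p * x) ^ d + of_nat d * (p * x) ^ d) sums
     (lambert p (p * x) + p * x / (1 - p * x)^2)"
    by (intro sums_add sums_lambert sums_koebe assms px)
  moreover have "of_nat d * p ^ d / (1 - p ^ d) * (p * x) ^ d + of_nat d * (p * x) ^ d =
     of_nat d * p ^ d / (1 - p ^ d) * x ^ d" for d
  proof (cases "d = 0")
    case False
    then have "1 - p ^ d \<noteq> 0"
      using norm_one_minus_power_ge[OF assms(1), of d] assms(1) by auto
    then show ?thesis by (simp add: power_mult_distrib field_simps)
  qed auto
  ultimately show ?thesis
    using sums_lambert[OF assms] sums_unique2 by fastforce
qed

lemma holomorphic_lambert:
  assumes p: "norm p < 1" "p \<noteq> 0" and f: "f holomorphic_on A" and im: "\<And>x. x \<in> A \<Longrightarrow> norm (f x) < 1 / norm p"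
  shows "(\<lambda>x. lambert p (f x)) holomorphic_on A"
proof -
  have "lambert p holomorphic_on ball 0 (1 / norm p)"
  proof (rule power_series_holomorphic)
    fix w :: complex assume "w \<in> ball 0 (1 / norm p)"
    then have "norm (p * w) < 1" using p by (simp add: norm_mult field_simps)
    then show "(\<lambda>d. of_nat d * p ^ d / (1 - p ^ d) * (w - 0) ^ d) sums lambert p w"
      using sums_lambert[OF p(1)] by simp
  qed
  moreover have "f ` A \<subseteq> ball 0 (1 / norm p)" using im by auto
  ultimately show ?thesis
    using holomorphic_on_compose_gen[OF f] by (auto simp: o_def)
qed

text \<open>The sum of f(p^k x) over all integers k, where f(x) = x / (1 - x)^2: the Weierstrass
  function up to normalisation, in the coordinate that turns one period into multiplication by
  \<open>p\<close>. The Lambert series collect k > 0 and k < 0, the latter by f(1/x) = f(x).\<close>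

definition wp :: "complex \<Rightarrow> complex \<Rightarrow> complex" where
  "wp p x = x / (1 - x)^2 + lambert p x + lambert p (1 / x)"

lemma wp_inverse: "x \<noteq> 0 \<Longrightarrow> wp p (1 / x) = wp p x"
  by (cases "x = 1") (auto simp: wp_def field_simps power2_eq_square)

text \<open>By \<open>lambert_shift\<close> one summand passes from the first Lambert series to the
  middle term, and one from the middle term to the second series. The bounds on \<open>x\<close>
  keep both \<open>x\<close> and \<open>p * x\<close> in the annulus.\<close>

lemma wp_mult_nome:
  assumes "norm p < 1" "p \<noteq> 0" "1 < norm x" "norm x < 1 / norm p"
  shows "wp p (p * x) = wp p x"
proof -
  have x: "x \<noteq> 0" "x \<noteq> 1" using assms by auto
  have "norm (p * x) < 1" using assms by (simp add: norm_mult field_simps)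
  then have "lambert p x = lambert p (p * x) + p * x / (1 - p * x)^2"
    using assms by (intro lambert_shift)
  moreover have "lambert p (1 / (p * x)) = lambert p (p * (1 / (p * x))) + p * (1 / (p * x)) / (1 - p * (1 / (p * x)))^2"
    using assms x by (intro lambert_shift) (auto simp: norm_divide)
  moreover have "1 / x / (1 - 1 / x)^2 = x / (1 - x)^2"
    using x by (simp add: divide_simps power2_eq_square) (simp add: algebra_simps)
  ultimately show ?thesis using assms x by (simp add: wp_def)
qed

text \<open>Differentiating the functional equation at 1 gives - g'(1) on the left and, because
  \<open>g 1 = 0\<close>, g'(1) on the right.\<close>

lemma deriv_eq_0_if_reciprocal:
  assumes hol: "g holomorphic_on S" "open S" "1 \<in> S"
    and "g 1 = 0" and recip: "\<And>x. x \<in> S \<Longrightarrow> g (1 / x) = g x / x^2"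
  shows "deriv g 1 = (0::complex)"
proof -
  have D: "(g has_field_derivative deriv g 1) (at 1)"
    using hol by (rule holomorphic_derivI)
  have "((\<lambda>x. g (1 / x)) has_field_derivative deriv g 1 * (-1)) (at 1)"
    by (rule DERIV_chain2[where f = g]) (use D in \<open>auto intro!: derivative_eq_intros\<close>)
  moreover have "((\<lambda>x. g x / x^2) has_field_derivative deriv g 1) (at 1)"
    using D \<open>g 1 = 0\<close> by (auto intro!: derivative_eq_intros)
  then have "((\<lambda>x. g (1 / x)) has_field_derivative deriv g 1) (at 1)"
    by (rule has_field_derivative_transform_within_open[OF _ hol(2,3)]) (simp add: recip)
  ultimately have "deriv g 1 * (-1) = deriv g 1" by (rule DERIV_unique)
  then show ?thesis by simp
qed

lemma norm_less_if_in_nome_annulus: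
  assumes "norm p < 1" "p \<noteq> 0" "x \<in> nome_annulus p"
  shows "norm (p * x) < 1" "norm (p / x) < 1" "x \<noteq> 0"
proof -
  show "x \<noteq> 0" using assms by auto
  then show "norm (p / x) < 1" using assms by (simp add: norm_divide)
  show "norm (p * x) < 1" using assms by (simp add: norm_mult field_simps)
qed

lemma theta_nonzero:
  assumes "norm p < 1" "p \<noteq> 0" "x \<in> nome_annulus p" "x \<noteq> 1"
  shows "theta p x \<noteq> 0"
  using norm_less_if_in_nome_annulus[OF assms(1-3)] assms
  by (auto simp: theta_alt qpoch_nonzero_norm)

lemma holomorphic_theta:
  assumes "norm p < 1" "f holomorphic_on A" "\<And>x. x \<in> A \<Longrightarrow> f x \<noteq> 0"
  shows "(\<lambda>x. theta p (f x)) holomorphic_on A"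
  unfolding theta_def using assms by (intro holomorphic_intros)

text \<open>With \<open>a\<close> replaced by a variable, the difference of the two sides is the
  function \<open>H\<close>, invariant under inversion and under multiplication by \<open>p\<close>.
  Its double pole at 1 cancels, so it extends to a holomorphic nome-periodic function, which is
  constant; it vanishes at \<open>b\<close>.\<close>

theorem wp_diff_eq_theta:
  assumes p: "norm p < 1" "p \<noteq> 0" and a: "a \<in> nome_annulus p" "a \<noteq> 1" and b: "b \<in> nome_annulus p" "b \<noteq> 1"
  shows "wp p a - wp p b = - b * qpoch p p ^ 4 * (theta p (a * b) * theta p (a / b)) / (theta p a ^ 2 * theta p b ^ 2)"
proof -
  note ann = norm_less_if_in_nome_annulus[OF p]
  have one: "1 \<in> nome_annulus p" using p by simp
  have b0: "b \<noteq> 0" and \<theta>b: "theta p b \<noteq> 0" using ann b theta_nonzero[OF p b] by auto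
  have Q: "qpoch p p \<noteq> 0" using p by (intro qpoch_nonzero_norm)
  \<comment> \<open>This constant makes the leading coefficients of the two double poles at 1
    cancel, which is \<open>g 1 = 0\<close> below.\<close>
  define C where "C = b * qpoch p p ^ 4 / theta p b ^ 2"
  define \<theta>1 where "\<theta>1 x = qpoch p (p * x) * qpoch p (p / x)" for x
  define F where "F x = theta p (x * b) * theta p (x / b)" for x
  define H where "H x = wp p x - wp p b + C * F x / theta p x ^ 2" for x
  \<comment> \<open>\<open>g\<close> is \<open>(1 - x)^2 * H x\<close>, written so that it is
    holomorphic at 1 too: \<open>\<theta>1\<close> is \<open>theta\<close> without its zero.\<close>
  define g where "g x = x + (1 - x)^2 * (lambert p x + lambert p (1 / x) - wp p b) + C * F x / \<theta>1 x ^ 2" for x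
  have \<theta>1: "theta p x = (1 - x) * \<theta>1 x" for x
    using theta_alt[OF p(1)] by (simp add: \<theta>1_def)
  have \<theta>1_nz: "\<theta>1 x \<noteq> 0" if "x \<in> nome_annulus p" for x
    using ann[OF that] p by (simp add: \<theta>1_def qpoch_nonzero_norm)
  have gH: "g x = (1 - x)^2 * H x" if "x \<noteq> 1" for x
    using that by (simp add: g_def H_def \<theta>1 wp_def power_mult_distrib distrib_left right_diff_distrib)
  have F_inverse: "F (1 / x) = F x / x^2" if "x \<noteq> 0" for x
  proof -
    have "F (1 / x) = theta p (1 / (x / b)) * theta p (1 / (x * b))"
      using that b0 by (simp add: F_def)
    also have "\<dots> = (- theta p (x / b) / (x / b)) * (- theta p (x * b) / (x * b))"
      using that b0 p by (simp only: theta_inverse mult_eq_0_iff divide_eq_0_iff simp_thms)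
    also have "\<dots> = F x / x^2"
      using that b0 by (simp add: F_def power2_eq_square)
    finally show ?thesis .
  qed
  have F_mult: "F (p * x) = F x / x^2" if "x \<noteq> 0" for x
  proof -
    have "F (p * x) = theta p (p * (x * b)) * theta p (p * (x / b))"
      using that b0 by (simp add: F_def mult_ac)
    also have "\<dots> = (- theta p (x * b) / (x * b)) * (- theta p (x / b) / (x / b))"
      using that b0 p by (simp only: theta_mult_nome mult_eq_0_iff divide_eq_0_iff simp_thms)
    also have "\<dots> = F x / x^2"
      using that b0 by (simp add: F_def power2_eq_square)
    finally show ?thesis .
  qed
  have H_inverse: "H (1 / x) = H x" if "x \<noteq> 0" for x
    using that p by (simp add: H_def wp_inverse F_inverse theta_inverse power_divide)
  have H_mult: "H (p * x) = H x" if "1 < norm x" "norm x < 1 / norm p" for x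
    using that p wp_mult_nome[OF p that] by (subgoal_tac "x \<noteq> 0") (auto simp: H_def F_mult theta_mult_nome power_divide)
  have g1: "g 1 = 0"
  proof -
    have "F 1 = - (theta p b ^ 2) / b"
      using theta_inverse[OF p(1) b0] by (simp add: F_def power2_eq_square)
    moreover have "\<theta>1 1 = qpoch p p ^ 2" by (simp add: \<theta>1_def power2_eq_square)
    ultimately show ?thesis
      using b0 \<theta>b Q by (simp add: g_def C_def flip: power_mult)
  qed
  have g_recip: "g (1 / x) = g x / x^2" if "x \<in> nome_annulus p" for x
  proof (cases "x = 1")
    case True
    then show ?thesis by (simp add: g1)
  next
    case False
    have "x \<noteq> 0" using ann that by auto
    then have "(1 - 1 / x)^2 = (1 - x)^2 / x^2"
      by (simp add: field_simps power2_eq_square)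
    then show ?thesis
      using False \<open>x \<noteq> 0\<close> by (simp add: gH H_inverse)
  qed
  have hol_g: "g holomorphic_on nome_annulus p"
    unfolding g_def F_def \<theta>1_def
    by (intro holomorphic_intros holomorphic_theta holomorphic_lambert p)
      (use \<theta>1_nz[unfolded \<theta>1_def] ann b0 inverse_in_nome_annulus[OF p(2)] in auto)
  \<comment> \<open>Two divisions by \<open>x - 1\<close> with the singularities removed. Since both
    \<open>g\<close> and its derivative vanish at 1, the outcome \<open>g2\<close> is
    \<open>H\<close> away from 1.\<close>
  define g1 where "g1 x = (if x = 1 then deriv g 1 else (g x - g 1) / (x - 1))" for x
  define g2 where "g2 x = (if x = 1 then deriv g1 1 else (g1 x - g1 1) / (x - 1))" for x
  have "g1 holomorphic_on nome_annulus p"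
    unfolding g1_def by (rule pole_lemma_open[OF hol_g open_nome_annulus])
  then have hol_g2: "g2 holomorphic_on nome_annulus p"
    unfolding g2_def by (rule pole_lemma_open[OF _ open_nome_annulus])
  have "deriv g 1 = 0"
    by (rule deriv_eq_0_if_reciprocal[OF hol_g open_nome_annulus one g1 g_recip])
  then have g2H: "g2 x = H x" if "x \<noteq> 1" for x
    using that by (simp add: g2_def g1_def \<open>g 1 = 0\<close> gH power2_eq_square divide_simps)
      (simp add: algebra_simps)
  have "g2 constant_on nome_annulus p"
  proof (rule nome_periodic_imp_constant[OF p hol_g2])
    fix x :: complex assume x: "1 < norm x" "norm x < 1 / norm p"
    then have "norm (p * x) < 1" using p by (simp add: norm_mult field_simps)
    with x have "x \<noteq> 1" "p * x \<noteq> 1" by auto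
    then show "g2 (p * x) = g2 x" using H_mult[OF x] by (simp add: g2H)
  qed
  then have "g2 a = g2 b" using a b by (auto simp: constant_on_def)
  then have "H a = H b" using a b by (simp add: g2H)
  moreover have "H b = 0" using b0 p by (simp add: H_def F_def)
  ultimately have "(wp p a - wp p b) + C * F a / theta p a ^ 2 = 0"
    by (simp add: H_def)
  then have "wp p a - wp p b = - C * F a / theta p a ^ 2"
    by (simp add: eq_neg_iff_add_eq_0)
  then show ?thesis by (simp add: C_def F_def mult_ac)
qed

section \<open>Product formulas for the two Lambert series\<close>

text \<open>Inside the unit disc the middle term of \<open>wp\<close> has a power series as well; 1
  + p^d / (1 - p^d) = 1 / (1 - p^d) merges it with the first Lambert series.\<close>

lemma wp_sums:
  assumes p: "norm p < 1" "p \<noteq> 0" and x: "norm p < norm x" "norm x < 1"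
  shows "(\<lambda>d. of_nat d * ((x ^ d + (p / x) ^ d) / (1 - p ^ d))) sums wp p x"
proof -
  have x0: "x \<noteq> 0" using x by auto
  have "norm p * norm x \<le> 1 * norm x" using p by (intro mult_right_mono) auto
  then have px: "norm (p * x) < 1" using x by (simp add: norm_mult)
  have px': "norm (p * (1 / x)) < 1" using x x0 by (simp add: norm_divide)
  have "(\<lambda>d. of_nat d * x ^ d + of_nat d * p ^ d / (1 - p ^ d) * x ^ d
      + of_nat d * p ^ d / (1 - p ^ d) * (1 / x) ^ d) sums wp p x"
    unfolding wp_def by (intro sums_add sums_koebe sums_lambert p x px px')
  moreover have "of_nat d * x ^ d + of_nat d * p ^ d / (1 - p ^ d) * x ^ d
      + of_nat d * p ^ d / (1 - p ^ d) * (1 / x) ^ d =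
      of_nat d * ((x ^ d + (p / x) ^ d) / (1 - p ^ d))" for d
  proof (cases "d = 0")
    case False
    then have "1 - p ^ d \<noteq> 0"
      using norm_one_minus_power_ge[OF p(1), of d] p(1) by auto
    then show ?thesis using x0 by (simp add: power_divide divide_simps) (simp add: algebra_simps)
  qed auto
  ultimately show ?thesis by simp
qed

definition chi5 :: "nat \<Rightarrow> int" where
  "chi5 n = (if n mod 5 = 1 \<or> n mod 5 = 4 then 1 else if n mod 5 = 2 \<or> n mod 5 = 3 then - 1 else 0)"

lemma norm_power_lt_1: "norm q < 1 \<Longrightarrow> k > 0 \<Longrightarrow> norm (q ^ k) < 1" for q :: complex
  by (simp add: norm_power power_less_one_iff)

text \<open>Passing from nome q^2 to q^10 leaves the exponents 1, 3, 5, 7, 9 and 2, 4, 6, 8, 10.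
  Exponents with sum 10 pair up to a theta function, and 5 or 10 remains.\<close>

lemma qpoch_quintuple:
  assumes q: "norm q < 1" "q \<noteq> 0"
  shows "qpoch (q^2) q = theta (q^10) q * theta (q^10) (q^3) * qpoch (q^10) (q^5)" (is ?th1)
    and "qpoch (q^2) (q^2) = theta (q^10) (q^2) * theta (q^10) (q^4) * qpoch (q^10) (q^10)" (is ?th2)
proof -
  have d: "q ^ m / q ^ k = q ^ (m - k)" if "k \<le> m" for m k
    using that q by (simp add: power_diff)
  have d1: "q ^ m / q = q ^ (m - 1)" if "1 \<le> m" for m
    using d[of 1 m] that by simp
  note split = qpoch_split[OF norm_power_lt_1[OF q(1), of 2], where k = 5]
  show ?th1
    by (subst split) (simp_all add: theta_def d d1 eval_nat_numeral flip: power_mult power_Suc power_Suc2 power_add)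
  show ?th2
    by (subst split) (simp_all add: theta_def d d1 eval_nat_numeral flip: power_mult power_Suc power_Suc2 power_add)
qed

text \<open>The series is \<open>wp\<close> at q minus \<open>wp\<close> at q^3 for the nome q^10:
  the exponents 1, 9 and 3, 7 are the odd residues modulo 10 where \<open>chi5\<close> is 1 and -1.
  In the theta quotient the values at q^4 and q^(-2) combine to (q^2; q^2), those at q and q^3 to
  (q; q^2), by \<open>qpoch_quintuple\<close>.\<close>

lemma lambert_B_product:
  assumes q: "norm q < 1" "q \<noteq> 0"
  shows "(\<lambda>d. of_nat d * ((q ^ d + (q ^ d) ^ 9 - (q ^ d) ^ 3 - (q ^ d) ^ 7) / (1 - (q ^ d) ^ 10))) sums
    (q * qpoch (q^2) (q^2) * qpoch (q^10) (q^10) ^ 3 * qpoch (q^10) (q^5) ^ 2 / qpoch (q^2) q ^ 2)"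
proof -
  let ?p = "q ^ 10"
  have n: "norm (q ^ j) < norm (q ^ i)" if "i < j" for i j
    using that q by (simp add: norm_power power_strict_decreasing)
  note lt = norm_power_lt_1[OF q(1)]
  have p: "norm ?p < 1" "?p \<noteq> 0" using q lt by auto
  have pinv: "1 < 1 / norm ?p" using p by simp
  have ann: "q ^ i \<in> nome_annulus ?p" "q ^ i \<noteq> 1" if "0 < i" "i < 10" for i
    using n[of i 10] that lt[of i] pinv by (auto simp del: norm_power)
  have diff: "wp ?p q - wp ?p (q^3) = - (q^3) * qpoch ?p ?p ^ 4 *
      (theta ?p (q * q^3) * theta ?p (q / q^3)) / (theta ?p q ^ 2 * theta ?p (q^3) ^ 2)"
    using wp_diff_eq_theta[OF p, of "q ^ 1" "q ^ 3"] ann[of 1] ann[of 3] by simp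
  have "theta ?p (q / q^3) = theta ?p (1 / q^2)"
    using q by (simp add: eval_nat_numeral)
  also have "\<dots> = - theta ?p (q^2) / q^2" using p q by (intro theta_inverse) auto
  finally have t1: "theta ?p (q / q^3) = - theta ?p (q^2) / q^2" .
  have t2: "theta ?p (q * q^3) = theta ?p (q^4)" by (simp add: eval_nat_numeral)
  have nz: "theta ?p q \<noteq> 0" "theta ?p (q^3) \<noteq> 0" "qpoch ?p ?p \<noteq> 0" "qpoch ?p (q^5) \<noteq> 0"
    using theta_nonzero[OF p] ann[of 1] ann[of 3] p lt[of 5] by (auto simp del: norm_power simp: qpoch_nonzero_norm)
  have "wp ?p q - wp ?p (q^3) = q * qpoch (q^2) (q^2) * qpoch ?p ?p ^ 3 * qpoch ?p (q^5) ^ 2 / qpoch (q^2) q ^ 2"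
    unfolding diff t1 t2 qpoch_quintuple[OF q] using nz q by (simp add: field_simps eval_nat_numeral)
  moreover have "(\<lambda>d. of_nat d * ((q ^ d + (?p / q) ^ d) / (1 - ?p ^ d)) -
      of_nat d * (((q^3) ^ d + (?p / q^3) ^ d) / (1 - ?p ^ d))) sums (wp ?p q - wp ?p (q^3))"
    using n[of 1 10] n[of 3 10] lt[of 3] p q by (intro sums_diff wp_sums) auto
  moreover have "of_nat d * ((q ^ d + (?p / q) ^ d) / (1 - ?p ^ d)) -
      of_nat d * (((q^3) ^ d + (?p / q^3) ^ d) / (1 - ?p ^ d)) =
      of_nat d * ((q ^ d + (q ^ d) ^ 9 - (q ^ d) ^ 3 - (q ^ d) ^ 7) / (1 - (q ^ d) ^ 10))" for d
  proof -
    have "?p / q = q ^ 9" "?p / q^3 = q ^ 7" using q by (simp_all add: eval_nat_numeral)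
    moreover have "(q ^ k) ^ d = (q ^ d) ^ k" for k by (simp add: mult.commute flip: power_mult)
    ultimately show ?thesis by (simp add: ring_distribs diff_divide_distrib add_divide_distrib)
  qed
  ultimately show ?thesis by simp
qed

section \<open>Fifth roots of unity and the second Lambert series\<close>

lemma exists_fifth_root_of_unity:
  obtains z :: complex where "z ^ 5 = 1" "z \<noteq> 1"
proof
  let ?z = "cis (2 * pi / 5)"
  show "?z ^ 5 = 1" unfolding Complex.DeMoivre by simp
  show "?z \<noteq> 1"
  proof
    assume "?z = 1"
    then have "sin (2 * pi / 5) = 0" by (simp add: complex_eq_iff)
    moreover have "sin (2 * pi / 5) > 0" by (intro sin_gt_zero) auto
    ultimately show False by simp
  qed
qed

lemma fifth_root_poly:
  fixes z :: complex
  assumes "z ^ 5 = 1" "z \<noteq> 1"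
  shows "z ^ 4 = - 1 - z - z^2 - z^3"
proof -
  have "(z - 1) * (z ^ 4 + z ^ 3 + z ^ 2 + z + 1) = z ^ 5 - 1"
    by (simp add: algebra_simps eval_nat_numeral)
  then have "z ^ 4 + z ^ 3 + z ^ 2 + z + 1 = 0" using assms by simp
  then show ?thesis by (simp add: add_eq_0_iff algebra_simps)
qed

lemma qpoch_fifth_roots:
  assumes "norm p < 1" "z ^ 5 = 1" "z \<noteq> 1"
  shows "qpoch p x * qpoch p (z * x) * qpoch p (z^2 * x) * qpoch p (z^3 * x) * qpoch p (z^4 * x) =
    qpoch (p^5) (x^5)"
proof -
  note z4 = fifth_root_poly[OF assms(2,3)]
  have "(\<Prod>i<5. 1 - z ^ i * t) = 1 - t ^ 5" for t
  proof -
    have "(\<Prod>i<5. 1 - z ^ i * t) = (1 - t) * (1 - z * t) * (1 - z^2 * t) * (1 - z^3 * t) * (1 - z^4 * t)"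
      by (simp add: eval_nat_numeral)
    also have "\<dots> = (1 - t) * ((1 - (z + z^4) * t + z^5 * t^2) * (1 - (z^2 + z^3) * t + z^5 * t^2))"
      by (simp add: algebra_simps eval_nat_numeral)
    also have "\<dots> = 1 - t ^ 5"
    proof -
      \<comment> \<open>The two Gaussian periods: their sum and their product are both -1, so each
        is a root of t^2 + t - 1.\<close>
      define u v where "u = z + z^4" and "v = z^2 + z^3"
      have v: "v = - 1 - u" using z4 by (simp add: u_def v_def)
      have "u * v = z^3 + z^4 + z^5 * z + z^5 * z^2"
        by (simp add: u_def v_def algebra_simps eval_nat_numeral)
      then have "u * v = - 1" using assms(2) z4 by simp
      then have "u * u = 1 - u" by (simp add: v algebra_simps)
      have "(1 - t) * ((1 - u * t + 1 * t^2) * (1 - (- 1 - u) * t + 1 * t^2)) =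
          (1 - t) * (1 + t + (2 - u - u * u) * t^2 + t^3 + t^4)"
        by (simp add: algebra_simps eval_nat_numeral)
      also have "\<dots> = 1 - t ^ 5"
        unfolding \<open>u * u = 1 - u\<close> by (simp add: algebra_simps eval_nat_numeral)
      finally show ?thesis
        unfolding assms(2) u_def[symmetric] v_def[symmetric] v .
    qed
    finally show ?thesis .
  qed
  then have "(\<Prod>i<5. qpoch p (z ^ i * x)) = qpoch (p ^ 5) (x ^ 5)"
    using assms(1) by (intro qpoch_prod_eq) auto
  then show ?thesis by (simp add: eval_nat_numeral)
qed

text \<open>The Gauss sum of \<open>chi5\<close>, twisted by \<open>d\<close>. Only
  \<open>d mod 5\<close> matters, which leaves five cases.\<close>

lemma fifth_root_gauss_sum:
  fixes z :: complex
  assumes "z ^ 5 = 1"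
  shows "(z ^ d + (z^4) ^ d) - ((z^2) ^ d + (z^3) ^ d) = (z + z^4 - z^2 - z^3) * of_int (chi5 d)"
proof -
  have red: "z ^ k = z ^ (k mod 5)" for k
  proof -
    have "z ^ k = z ^ (5 * (k div 5) + k mod 5)" by simp
    also have "\<dots> = z ^ (k mod 5)" by (simp only: power_add power_mult assms power_one mult_1)
    finally show ?thesis .
  qed
  have "(z ^ d + (z^4) ^ d) - ((z^2) ^ d + (z^3) ^ d) =
    (z ^ (d mod 5) + z ^ (4 * (d mod 5) mod 5)) - (z ^ (2 * (d mod 5) mod 5) + z ^ (3 * (d mod 5) mod 5))"
    by (simp only: power_mult[symmetric] mod_mult_right_eq red[of d] red[of "4 * d"] red[of "2 * d"] red[of "3 * d"])
  also have "\<dots> = (z + z^4 - z^2 - z^3) * of_int (chi5 d)"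
  proof -
    have "d mod 5 < 5" by simp
    then consider "d mod 5 = 0" | "d mod 5 = 1" | "d mod 5 = 2" | "d mod 5 = 3" | "d mod 5 = 4" by linarith
    then show ?thesis by cases (simp_all add: chi5_def)
  qed
  finally show ?thesis .
qed

text \<open>The difference of \<open>wp\<close> at \<open>z * q\<close> and \<open>z^2 * q\<close>
  for the nome q^2 is the series multiplied by the Gauss sum \<open>c\<close>. In the theta quotient
  the factors at the fifth roots of unity collapse to symbols with nome q^10, and \<open>c\<close>
  reappears as a factor and cancels.\<close>

lemma lambert_A_product:
  assumes q: "norm q < 1" "q \<noteq> 0"
  shows "(\<lambda>d. of_nat d * (of_int (chi5 d) * (q ^ d / (1 - (q ^ d)^2)))) sums
    (q * qpoch (q^2) (q^2) ^ 3 * qpoch (q^10) (q^10) * qpoch (q^2) q ^ 2 / qpoch (q^10) (q^5) ^ 2)"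
proof -
  obtain z :: complex where z: "z ^ 5 = 1" "z \<noteq> 1" by (rule exists_fifth_root_of_unity)
  note z4 = fifth_root_poly[OF z]
  let ?p = "q^2"
  define c where "c = z + z^4 - z^2 - z^3"
  \<comment> \<open>The factored Gauss sum shows that \<open>c\<close> is nonzero, and it is the
    form in which \<open>c\<close> comes out of the theta quotient.\<close>
  have c: "c = z * (1 - z) * (1 - z^2)"
    by (simp add: c_def algebra_simps eval_nat_numeral)
  have z0: "z \<noteq> 0" using z by auto
  have "z^2 \<noteq> 1"
  proof
    assume "z^2 = 1"
    have "z ^ 5 = z * (z^2)^2" by (simp add: eval_nat_numeral)
    with \<open>z^2 = 1\<close> z show False by simp
  qed
  have "c \<noteq> 0" using z0 z \<open>z^2 \<noteq> 1\<close> by (simp add: c)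
  have "norm z ^ 5 = 1" using z by (metis norm_one norm_power)
  then have nz: "norm z = 1" using power_eq_imp_eq_base[of "norm z" 5 1] by simp
  have p: "norm ?p < 1" "?p \<noteq> 0" using q norm_power_lt_1[of q 2] by auto
  have pq: "norm ?p < norm q" using q by (simp add: norm_mult power2_eq_square)
  have pinv: "1 < 1 / norm ?p" using p by simp
  have norms: "norm (z ^ i * q) = norm q" for i by (simp add: norm_mult norm_power nz)
  have ann: "z ^ i * q \<in> nome_annulus ?p" "z ^ i * q \<noteq> 1" for i
  proof -
    have "norm q < 1 / norm ?p" using pinv q by linarith
    then show "z ^ i * q \<in> nome_annulus ?p" unfolding mem_Collect_eq norms using pq by blast
    show "z ^ i * q \<noteq> 1" using norms[of i] q by auto
  qed
  have diff: "wp ?p (z * q) - wp ?p (z^2 * q) = - (z^2 * q) * qpoch ?p ?p ^ 4 *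
      (theta ?p ((z * q) * (z^2 * q)) * theta ?p ((z * q) / (z^2 * q))) /
      (theta ?p (z * q) ^ 2 * theta ?p (z^2 * q) ^ 2)"
    using wp_diff_eq_theta[OF p, of "z ^ 1 * q" "z ^ 2 * q"] ann[of 1] ann[of 2] by simp
  have zinv: "1 / z = z^4" "1 / z^2 = z^3" "1 / z^3 = z^2" "1 / z^4 = z"
    using z z0 by (simp_all add: field_simps eval_nat_numeral)
  have "theta ?p ((z * q) * (z^2 * q)) = theta ?p (?p * z^3)"
    by (simp add: eval_nat_numeral mult_ac)
  also have "\<dots> = - theta ?p (z^3) / z^3" using p z0 by (intro theta_mult_nome) auto
  also have "theta ?p (z^3) = - theta ?p (z^2) / z^2"
    unfolding zinv(2)[symmetric] using p z0 by (intro theta_inverse) auto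
  finally have t1: "theta ?p ((z * q) * (z^2 * q)) = theta ?p (z^2) / z ^ 5"
    using z0 by (simp add: eval_nat_numeral)
  have "theta ?p ((z * q) / (z^2 * q)) = theta ?p (1 / z)"
    using q z0 by (simp add: power2_eq_square)
  also have "\<dots> = - theta ?p z / z" using p z0 by (intro theta_inverse) auto
  finally have t2: "theta ?p ((z * q) / (z^2 * q)) = - theta ?p z / z" .
  let ?x = "qpoch ?p q" and ?y = "qpoch (q^10) (q^5)" and ?P = "qpoch ?p ?p" and ?R = "qpoch (q^10) (q^10)"
  have pw: "?p ^ 5 = q ^ 10" by (simp flip: power_mult)
  \<comment> \<open>As 1/z = z^4 and 1/z^2 = z^3, the two theta functions cover the four nontrivial
    fifth roots, and \<open>?P\<close> supplies the trivial one.\<close>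
  have t3: "?P * (theta ?p z * theta ?p (z^2)) = (1 - z) * (1 - z^2) * ?R"
  proof -
    have "theta ?p z * theta ?p (z^2) = (1 - z) * (1 - z^2) *
        (qpoch ?p (z * ?p) * qpoch ?p (z^2 * ?p) * qpoch ?p (z^3 * ?p) * qpoch ?p (z^4 * ?p))"
      unfolding theta_alt[OF p(1)] zinv(1,2)[symmetric] by (simp add: mult_ac)
    then show ?thesis
      using qpoch_fifth_roots[OF p(1) z, of ?p] by (simp add: pw mult_ac)
  qed
  have t4: "?x * (theta ?p (z * q) * theta ?p (z^2 * q)) = ?y"
  proof -
    have "?p / (z * q) = z^4 * q" "?p / (z^2 * q) = z^3 * q"
      unfolding zinv(1,2)[symmetric] using q z0 by (simp_all add: power2_eq_square)
    then show ?thesis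
      using qpoch_fifth_roots[OF p(1) z, of q] by (simp add: theta_def pw mult_ac)
  qed
  have P0: "?P \<noteq> 0" "?x \<noteq> 0" "?y \<noteq> 0"
    using q p norm_power_lt_1[OF q(1)] by (simp_all add: qpoch_nonzero_norm)
  have "wp ?p (z * q) - wp ?p (z^2 * q) =
     z * q * ?P ^ 4 * (theta ?p z * theta ?p (z^2)) / (theta ?p (z * q) * theta ?p (z^2 * q)) ^ 2"
    unfolding diff t1 t2 z(1) using z0 by (simp add: power_mult_distrib power2_eq_square mult_ac)
  also have "theta ?p z * theta ?p (z^2) = (1 - z) * (1 - z^2) * ?R / ?P"
    using t3 P0 by (simp add: field_simps)
  also have "theta ?p (z * q) * theta ?p (z^2 * q) = ?y / ?x"
    using t4 P0 by (simp add: field_simps)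
  also have "z * q * ?P ^ 4 * ((1 - z) * (1 - z^2) * ?R / ?P) / (?y / ?x) ^ 2 =
     c * (q * ?P ^ 3 * ?R * ?x ^ 2 / ?y ^ 2)"
    unfolding c using P0 by (simp add: power_divide eval_nat_numeral mult_ac)
  finally have val: "wp ?p (z * q) - wp ?p (z^2 * q) = c * (q * ?P ^ 3 * ?R * ?x ^ 2 / ?y ^ 2)" .
  have "(\<lambda>d. of_nat d * (((z * q) ^ d + (?p / (z * q)) ^ d) / (1 - ?p ^ d)) -
      of_nat d * (((z^2 * q) ^ d + (?p / (z^2 * q)) ^ d) / (1 - ?p ^ d))) sums
      (wp ?p (z * q) - wp ?p (z^2 * q))"
    using p pq q norms[of 1] norms[of 2] by (intro sums_diff wp_sums) auto
  moreover have "of_nat d * (((z * q) ^ d + (?p / (z * q)) ^ d) / (1 - ?p ^ d)) -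
      of_nat d * (((z^2 * q) ^ d + (?p / (z^2 * q)) ^ d) / (1 - ?p ^ d)) =
      c * (of_nat d * (of_int (chi5 d) * (q ^ d / (1 - (q ^ d)^2))))" for d
  proof -
    have e: "?p / (z * q) = z^4 * q" "?p / (z^2 * q) = z^3 * q"
      unfolding zinv(1,2)[symmetric] using q z0 by (simp_all add: power2_eq_square)
    have "(q^2) ^ d = (q ^ d)^2" by (simp add: mult.commute flip: power_mult)
    then have "of_nat d * (((z * q) ^ d + (?p / (z * q)) ^ d) / (1 - ?p ^ d)) -
      of_nat d * (((z^2 * q) ^ d + (?p / (z^2 * q)) ^ d) / (1 - ?p ^ d)) =
      of_nat d * (((z ^ d + (z^4) ^ d) - ((z^2) ^ d + (z^3) ^ d)) * (q ^ d / (1 - (q ^ d)^2)))"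
      unfolding e by (simp add: power_mult_distrib ring_distribs diff_divide_distrib add_divide_distrib)
    then show ?thesis
      unfolding fifth_root_gauss_sum[OF z(1)] c_def[symmetric] by (simp add: mult_ac)
  qed
  ultimately have "(\<lambda>d. c * (of_nat d * (of_int (chi5 d) * (q ^ d / (1 - (q ^ d)^2))))) sums
      (c * (q * ?P ^ 3 * ?R * ?x ^ 2 / ?y ^ 2))"
    by (simp only: val)
  then show ?thesis using sums_mult_iff[OF \<open>c \<noteq> 0\<close>] by blast
qed

section \<open>Rearranging the Lambert double series into divisor sums\<close>

lemma has_sum_Times_mult:
  fixes f :: "'a \<Rightarrow> complex" and g :: "'b \<Rightarrow> complex"
  assumes f: "(f has_sum a) A" and g: "(g has_sum b) B"
  shows "((\<lambda>(x, y). f x * g y) has_sum a * b) (A \<times> B)"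
proof (rule has_sum_SigmaI[where g = "\<lambda>x. f x * b"])
  show "((\<lambda>y. case (x, y) of (x, y) \<Rightarrow> f x * g y) has_sum f x * b) B" for x
    using has_sum_cmult_right[OF g, of "f x"] by simp
  show "((\<lambda>x. f x * b) has_sum a * b) A"
    by (rule has_sum_cmult_left[OF f])
  have nf: "(\<lambda>x. norm (f x)) summable_on A" and ng: "(\<lambda>x. norm (g x)) summable_on B"
    using f g by (auto simp: summable_on_iff_abs_summable_on_complex[symmetric] summable_on_def)
  have "(\<lambda>(x, y). norm (f x) * norm (g y)) summable_on A \<times> B"
    by (rule summable_on_SigmaI[where g = "\<lambda>x. norm (f x) * infsum (\<lambda>y. norm (g y)) B"])
      (auto intro!: has_sum_cmult_right has_sum_infsum ng summable_on_cmult_left nf)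
  then have "(\<lambda>z. norm (case z of (x, y) \<Rightarrow> f x * g y)) summable_on A \<times> B"
    by (simp add: case_prod_unfold norm_mult)
  then show "(\<lambda>(x, y). f x * g y) summable_on A \<times> B"
    by (rule abs_summable_summable)
qed

lemma has_sum_geometric:
  fixes z :: complex
  assumes "norm z < 1"
  shows "((\<lambda>n. z ^ n) has_sum 1 / (1 - z)) UNIV"
proof (rule norm_summable_imp_has_sum)
  show "summable (\<lambda>n. norm (z ^ n))" using assms by (simp add: norm_power summable_geometric)
  show "(\<lambda>n. z ^ n) sums (1 / (1 - z))" using assms by (rule geometric_sums)
qed

text \<open>With \<open>e = m * k + r\<close> the series is a geometric series in
  \<open>z ^ k\<close> times a finite sum over the residues \<open>r\<close>.\<close>

lemma has_sum_periodic_powser: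
  fixes z :: complex
  assumes z: "norm z < 1" and k: "k > 0" and per: "\<And>e. g (e mod k) = g e"
  shows "((\<lambda>e. g e * z ^ e) has_sum (\<Sum>r<k. g r * z ^ r) / (1 - z ^ k)) UNIV"
proof -
  have "((\<lambda>(m, r). (z ^ k) ^ m * (g r * z ^ r)) has_sum 1 / (1 - z ^ k) * (\<Sum>r<k. g r * z ^ r)) (UNIV \<times> {..<k})"
    by (intro has_sum_Times_mult has_sum_geometric norm_power_lt_1 z k has_sum_finite) auto
  also have "?this \<longleftrightarrow> ((\<lambda>e. g e * z ^ e) has_sum (\<Sum>r<k. g r * z ^ r) / (1 - z ^ k)) UNIV"
  proof (rule has_sum_reindex_bij_witness[of _ "\<lambda>e. (e div k, e mod k)" "\<lambda>(m, r). m * k + r"])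
    fix x :: "nat \<times> nat" assume "x \<in> UNIV \<times> {..<k}"
    then obtain m r where x: "x = (m, r)" "r < k" by auto
    have "g (m * k + r) = g r" using per[of "m * k + r"] x by simp
    then show "g (case x of (m, r) \<Rightarrow> m * k + r) * z ^ (case x of (m, r) \<Rightarrow> m * k + r) =
        (case x of (m, r) \<Rightarrow> (z ^ k) ^ m * (g r * z ^ r))"
      by (simp add: x power_add mult_ac flip: power_mult)
  qed (use k in auto)
  finally show ?thesis .
qed

lemma has_sum_odd_powers:
  fixes z :: complex
  assumes "norm z < 1"
  shows "((\<lambda>e. z ^ e) has_sum z / (1 - z^2)) {e. odd e}"
proof -
  have "((\<lambda>e. of_bool (odd e) * z ^ e) has_sum (\<Sum>r<2. of_bool (odd r) * z ^ r) / (1 - z ^ 2)) UNIV"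
    by (rule has_sum_periodic_powser[OF assms]) (auto simp: of_bool_def odd_iff_mod_2_eq_one)
  also have "(\<Sum>r<2. of_bool (odd r) * z ^ r) = z"
    by (simp add: numeral_2_eq_2)
  finally have "((\<lambda>e. of_bool (odd e) * z ^ e) has_sum z / (1 - z ^ 2)) UNIV" .
  also have "?this \<longleftrightarrow> ((\<lambda>e. z ^ e) has_sum z / (1 - z^2)) {e. odd e}"
    by (intro has_sum_cong_neutral) auto
  finally show ?thesis .
qed

lemma has_sum_odd_powers_chi5:
  fixes z :: complex
  assumes "norm z < 1"
  shows "((\<lambda>e. of_int (chi5 e) * z ^ e) has_sum (z + z ^ 9 - z ^ 3 - z ^ 7) / (1 - z ^ 10)) {e. odd e}"
proof -
  let ?g = "\<lambda>e. of_bool (odd e) * of_int (chi5 e) :: complex"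
  have per: "?g (e mod 10) = ?g e" for e
  proof -
    have "e mod 10 mod 5 = e mod 5" "e mod 10 mod 2 = e mod 2" by (simp_all add: mod_mod_cancel)
    then show ?thesis by (simp add: chi5_def odd_iff_mod_2_eq_one)
  qed
  have "{..<10::nat} = {0,1,2,3,4,5,6,7,8,9}" by auto
  then have "(\<Sum>r<10. ?g r * z ^ r) = z + z ^ 9 - z ^ 3 - z ^ 7"
    by (simp add: chi5_def)
  with has_sum_periodic_powser[of z 10 ?g, OF assms _ per]
  have "((\<lambda>e. ?g e * z ^ e) has_sum (z + z ^ 9 - z ^ 3 - z ^ 7) / (1 - z ^ 10)) UNIV"
    by simp
  also have "?this \<longleftrightarrow> ?thesis"
    by (intro has_sum_cong_neutral) auto
  finally show ?thesis .
qed

text \<open>The coefficient of q^m in B - A, with \<open>m div d\<close> as the odd variable of the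
  double series. For \<open>m = 0\<close> the index set is empty, because \<open>0 div d\<close> is
  even.\<close>

definition divisor_coeff :: "nat \<Rightarrow> int" where
  "divisor_coeff m = (\<Sum>d | d dvd m \<and> odd (m div d). int d * (chi5 (m div d) - chi5 d))"

text \<open>For positive \<open>d\<close> and \<open>e\<close>, (d - 1)(e - 1) >= 0 gives d e >= d -
  1 + e. The terms are therefore dominated by twice the product of d r^(d-1) and r^e, where r is the
  norm of \<open>q\<close>.\<close>

lemma summable_lambert_double:
  fixes q :: complex
  assumes "norm q < 1"
  shows "(\<lambda>(d, e). of_int (int d * (chi5 e - chi5 d)) * q ^ (d * e)) summable_on {0<..} \<times> {e. odd e}"
proof -
  define r where "r = norm q"
  have r: "0 \<le> r" "r < 1" using assms by (auto simp: r_def)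
  have "((\<lambda>d. of_nat (Suc d) * complex_of_real r ^ d) has_sum 1 / (1 - complex_of_real r)^2) UNIV"
  proof (rule norm_summable_imp_has_sum)
    have "summable (\<lambda>d. of_real (real (Suc d) * r ^ d) :: complex)"
      using geometric_deriv_sums[of "complex_of_real r"] r by (simp add: sums_iff)
    then have "summable (\<lambda>d. real (Suc d) * r ^ d)" by (simp only: summable_of_real_iff)
    then show "summable (\<lambda>d. norm (of_nat (Suc d) * complex_of_real r ^ d))"
      using r by (simp add: norm_mult norm_power del: of_nat_Suc)
  qed (use geometric_deriv_sums[of "complex_of_real r"] r in auto)
  then have "((\<lambda>(d, e). (of_nat (Suc d) * complex_of_real r ^ d) * complex_of_real r ^ e) has_sum
      1 / (1 - complex_of_real r)^2 * (complex_of_real r / (1 - complex_of_real r ^ 2))) (UNIV \<times> {e. odd e})"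
    using r by (intro has_sum_Times_mult has_sum_odd_powers) auto
  then have "(\<lambda>(d, e). (of_nat (Suc d) * complex_of_real r ^ d) * complex_of_real r ^ e) summable_on UNIV \<times> {e. odd e}"
    by (auto simp: summable_on_def)
  also have "?this \<longleftrightarrow> (\<lambda>(d, e). of_nat d * complex_of_real r ^ (d - 1) * complex_of_real r ^ e) summable_on {0<..} \<times> {e. odd e}"
    by (rule summable_on_reindex_bij_witness[of _ "\<lambda>(d, e). (d - 1, e)" "\<lambda>(d, e). (Suc d, e)"]) auto
  finally have "(\<lambda>z. norm (2 * (case z of (d, e) \<Rightarrow> of_nat d * complex_of_real r ^ (d - 1) * complex_of_real r ^ e)))
     summable_on {0<..} \<times> {e. odd e}"
    by (subst summable_on_iff_abs_summable_on_complex[symmetric]) (rule summable_on_cmult_right)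
  then have "(\<lambda>z. norm (case z of (d, e) \<Rightarrow> of_int (int d * (chi5 e - chi5 d)) * q ^ (d * e))) summable_on {0<..} \<times> {e. odd e}"
  proof (rule Infinite_Sum.abs_summable_on_comparison_test)
    fix z :: "nat \<times> nat" assume "z \<in> {0<..} \<times> {e. odd e}"
    then obtain d e where z: "z = (d, e)" "d > 0" "odd e" by auto
    then have e: "e > 0" by (auto intro: Nat.gr0I)
    then obtain d' e' where de: "d = Suc d'" "e = Suc e'" using z gr0_implies_Suc by metis
    then have "r ^ (d * e) \<le> r ^ (d - 1 + e)" using r by (intro power_decreasing) auto
    moreover have "\<bar>real_of_int (chi5 e - chi5 d)\<bar> \<le> 2" by (simp add: chi5_def)
    ultimately have "real d * \<bar>real_of_int (chi5 e - chi5 d)\<bar> * r ^ (d * e) \<le> real d * 2 * r ^ (d - 1 + e)"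
      using r by (intro mult_mono) auto
    moreover have "norm (of_int (int d * (chi5 e - chi5 d)) * q ^ (d * e)) =
        real d * \<bar>real_of_int (chi5 e - chi5 d)\<bar> * r ^ (d * e)"
      by (simp only: norm_mult norm_of_int norm_of_nat norm_power r_def[symmetric] of_int_mult of_int_of_nat_eq)
    moreover have "norm (2 * (of_nat d * complex_of_real r ^ (d - 1) * complex_of_real r ^ e)) =
        real d * 2 * r ^ (d - 1 + e)"
      using r by (simp add: norm_mult norm_power power_add)
    ultimately show "norm (case z of (d, e) \<Rightarrow> of_int (int d * (chi5 e - chi5 d)) * q ^ (d * e)) \<le>
        norm (2 * (case z of (d, e) \<Rightarrow> of_nat d * complex_of_real r ^ (d - 1) * complex_of_real r ^ e))"
      by (simp only: z case_prod_conv)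
  qed
  then show ?thesis by (rule abs_summable_summable)
qed

text \<open>One absolutely convergent double sum is evaluated in two ways: for fixed
  \<open>d\<close> first, which gives the two Lambert series, and along \<open>d * e = m\<close>,
  which gives the divisor sums.\<close>

lemma has_sum_divisor_coeff:
  fixes q :: complex
  assumes q: "norm q < 1"
    and B: "(\<lambda>d. of_nat d * ((q ^ d + (q ^ d) ^ 9 - (q ^ d) ^ 3 - (q ^ d) ^ 7) / (1 - (q ^ d) ^ 10))) sums b"
    and A: "(\<lambda>d. of_nat d * (of_int (chi5 d) * (q ^ d / (1 - (q ^ d)^2)))) sums a"
  shows "((\<lambda>m. of_int (divisor_coeff m) * q ^ m) has_sum (b - a)) {0<..}"
proof -
  let ?f = "\<lambda>(d, e). of_int (int d * (chi5 e - chi5 d)) * q ^ (d * e)"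
  let ?g = "\<lambda>d. of_nat d * ((q ^ d + (q ^ d) ^ 9 - (q ^ d) ^ 3 - (q ^ d) ^ 7) / (1 - (q ^ d) ^ 10))
      - of_nat d * (of_int (chi5 d) * (q ^ d / (1 - (q ^ d)^2)))"
  have inner: "((\<lambda>e. ?f (d, e)) has_sum ?g d) {e. odd e}" if "d > 0" for d
  proof -
    have lt: "norm (q ^ d) < 1" using q that by (rule norm_power_lt_1)
    have "((\<lambda>e. of_nat d * (of_int (chi5 e) * (q ^ d) ^ e) + (- of_nat d * of_int (chi5 d)) * (q ^ d) ^ e) has_sum
        (of_nat d * ((q ^ d + (q ^ d) ^ 9 - (q ^ d) ^ 3 - (q ^ d) ^ 7) / (1 - (q ^ d) ^ 10))
      + (- of_nat d * of_int (chi5 d)) * (q ^ d / (1 - (q ^ d)^2)))) {e. odd e}"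
      by (intro has_sum_add has_sum_cmult_right has_sum_odd_powers has_sum_odd_powers_chi5 lt)
    then show ?thesis by (simp add: power_mult algebra_simps)
  qed
  have sum: "(?f has_sum infsum ?f ({0<..} \<times> {e. odd e})) ({0<..} \<times> {e. odd e})"
    using summable_lambert_double[OF q] by (rule has_sum_infsum)
  have "(?g has_sum infsum ?f ({0<..} \<times> {e. odd e})) {0<..}"
    by (rule has_sum_SigmaD[OF sum]) (use inner in auto)
  also have "?this \<longleftrightarrow> (?g has_sum infsum ?f ({0<..} \<times> {e. odd e})) UNIV"
    by (rule has_sum_cong_neutral) auto
  finally have "?g sums infsum ?f ({0<..} \<times> {e. odd e})"
    by (rule has_sum_imp_sums)
  moreover have "?g sums (b - a)" by (rule sums_diff[OF B A])
  ultimately have "infsum ?f ({0<..} \<times> {e. odd e}) = b - a" by (rule sums_unique2)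
  with sum have "(?f has_sum (b - a)) ({0<..} \<times> {e. odd e})" by simp
  also have "?this \<longleftrightarrow> ((\<lambda>(m, d). of_int (int d * (chi5 (m div d) - chi5 d)) * q ^ m) has_sum (b - a))
      (SIGMA m:{0<..}. {d. d dvd m \<and> odd (m div d)})"
    by (rule has_sum_reindex_bij_witness[of _ "\<lambda>(m, d). (d, m div d)" "\<lambda>(d, e). (d * e, d)"])
      (auto intro: Nat.gr0I elim!: dvdE)
  finally have S: "((\<lambda>(m, d). of_int (int d * (chi5 (m div d) - chi5 d)) * q ^ m) has_sum (b - a))
      (SIGMA m:{0<..}. {d. d dvd m \<and> odd (m div d)})" .
  show ?thesis
  proof (rule has_sum_SigmaD[OF S])
    fix m :: nat assume "m \<in> {0<..}"
    then have "finite {d. d dvd m \<and> odd (m div d)}" by simp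
    then show "((\<lambda>d. case (m, d) of (m, d) \<Rightarrow> of_int (int d * (chi5 (m div d) - chi5 d)) * q ^ m)
      has_sum of_int (divisor_coeff m) * q ^ m) {d. d dvd m \<and> odd (m div d)}"
      by (intro has_sum_finiteI) (auto simp: divisor_coeff_def sum_distrib_right)
  qed
qed

section \<open>Theta series\<close>

text \<open>The triple product for the nome q^(2j) at \<open>(- q) ^ a\<close>. Since
  \<open>a\<close> is odd, this point is \<open>- (q ^ a)\<close>, and the nome is also a power of
  \<open>- q\<close>, so every term is a single power of \<open>- q\<close>.\<close>

lemma theta_series:
  fixes a j :: nat
  assumes q: "norm q < 1" "q \<noteq> 0" and a: "odd a" "a < 2 * j"
  shows "((\<lambda>n::int. (- q) powi (int j * n\<^sup>2 + (int a - int j) * n)) has_sum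
    qpoch (q ^ (2 * j)) (q ^ (2 * j)) * qpoch (q ^ (2 * j)) (q ^ a) * qpoch (q ^ (2 * j)) (q ^ (2 * j - a))) UNIV"
proof -
  let ?w = "- q" and ?p = "q ^ (2 * j)"
  have j: "j > 0" using a by auto
  have w: "?w \<noteq> 0" using q by simp
  have wa: "?w ^ a = - (q ^ a)" and wp: "?w ^ (2 * j) = ?p" using a by auto
  have "?p / ?w ^ a = - (q ^ (2 * j - a))"
    unfolding wa using a q by (simp add: power_diff)
  moreover have "norm ?p < 1" "?p \<noteq> 0" using q j by (simp_all add: norm_power_lt_1 del: norm_power)
  ultimately have "((\<lambda>n. (?w ^ a) powi n * ?p powi (n * (n - 1) div 2)) has_sum
    qpoch ?p ?p * qpoch ?p (q ^ a) * qpoch ?p (q ^ (2 * j - a))) UNIV"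
    using jacobi_triple_product[of ?p "?w ^ a"] w wa by simp
  moreover have "(?w ^ a) powi n * ?p powi (n * (n - 1) div 2) = ?w powi (int j * n\<^sup>2 + (int a - int j) * n)" for n :: int
  proof -
    have "even (n * (n - 1))" by simp
    then have "2 * (n * (n - 1) div 2) = n * (n - 1)" by simp
    then have e: "int (2 * j) * (n * (n - 1) div 2) = int j * (n * (n - 1))"
      by (metis (no_types, lifting) mult.assoc mult.commute of_nat_mult of_nat_numeral)
    have "(?w ^ a) powi n = ?w powi (int a * n)"
      by (simp add: power_int_mult)
    moreover have "?p powi (n * (n - 1) div 2) = ?w powi (int (2 * j) * (n * (n - 1) div 2))"
      unfolding wp[symmetric] by (simp only: power_int_mult power_int_of_nat)
    ultimately have "(?w ^ a) powi n * ?p powi (n * (n - 1) div 2) = ?w powi (int a * n + int j * (n * (n - 1)))"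
      unfolding e using w by (simp add: power_int_add)
    also have "int a * n + int j * (n * (n - 1)) = int j * n\<^sup>2 + (int a - int j) * n"
      by (simp add: algebra_simps power2_eq_square)
    finally show ?thesis .
  qed
  ultimately show ?thesis by simp
qed

text \<open>
  Splits \<open>\<int>\<^sup>2\<close> by the residue of \<open>u + 2 * v\<close> modulo 5. In Gaussian integers, the class of 0 is the
  ideal generated by \<open>2 - \<i>\<close>, and the other four classes are cosets of it.
\<close>

lemma theta_square_dissection:
  fixes w :: complex
  assumes w: "w \<noteq> 0"
    and \<phi>: "((\<lambda>n::int. w powi (n\<^sup>2)) has_sum a) UNIV"
    and \<phi>5: "((\<lambda>n::int. w powi (5 * n\<^sup>2)) has_sum b) UNIV"
    and f: "((\<lambda>n::int. w powi (5 * n\<^sup>2 + 4 * n)) has_sum c) UNIV"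
    and g: "((\<lambda>n::int. w powi (5 * n\<^sup>2 + 2 * n)) has_sum d) UNIV"
  shows "a\<^sup>2 = b\<^sup>2 + 4 * w * c * d"
proof -
  define F where "F = (\<lambda>(u::int, v::int). w powi (u\<^sup>2 + v\<^sup>2))"
  define C where "C i = {(u::int, v::int). (u + 2 * v) mod 5 = i}" for i
  have total: "(F has_sum a\<^sup>2) UNIV"
    using has_sum_Times_mult[OF \<phi> \<phi>] w by (simp add: F_def power_int_add power2_eq_square)
  \<comment> \<open>\<open>K v k\<close> is the preimage of the point with second coordinate
    \<open>v\<close> and \<open>u + 2 * v = 5 * k + i\<close>, so \<open>G\<close> maps onto the
    class.\<close>
  have coset: "(F has_sum S) (C i)"
    if G: "inj G" "\<And>m n. G (m, n) \<in> C i" "\<And>v k. G (K v k) = (5 * k + i - 2 * v, v)"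
      and S: "((\<lambda>x. F (G x)) has_sum S) UNIV"
    for G :: "int \<times> int \<Rightarrow> int \<times> int" and K and i :: int and S
  proof -
    have "C i \<subseteq> range G"
    proof clarify
      fix u v assume "(u, v) \<in> C i"
      then have "u + 2 * v = 5 * ((u + 2 * v) div 5) + i" by (auto simp: C_def)
      then have "(u, v) = (5 * ((u + 2 * v) div 5) + i - 2 * v, v)" by simp
      then show "(u, v) \<in> range G" using G(3) by (metis rangeI)
    qed
    moreover have "G x \<in> C i" for x using G(2) by (cases x) simp
    ultimately have "range G = C i" by blast
    with S show ?thesis
      using has_sum_reindex[OF G(1), of F S] by (simp add: o_def)
  qed
  have C0: "(F has_sum b\<^sup>2) (C 0)"
  \<comment> \<open>The map multiplies m + n i by 2 - i, whose norm is 5.\<close>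
  proof (rule coset[where G = "\<lambda>(m, n). (2 * m + n, 2 * n - m)" and K = "\<lambda>v k. (2 * k - v, k)"])
    have "F (2 * m + n, 2 * n - m) = w powi (5 * m\<^sup>2) * w powi (5 * n\<^sup>2)" for m n :: int
    proof -
      have "(2 * m + n)\<^sup>2 + (2 * n - m)\<^sup>2 = 5 * m\<^sup>2 + 5 * n\<^sup>2"
        by (simp add: power2_eq_square algebra_simps)
      then have "F (2 * m + n, 2 * n - m) = w powi (5 * m\<^sup>2 + 5 * n\<^sup>2)"
        by (simp only: F_def case_prod_conv)
      then show ?thesis using w by (simp add: power_int_add)
    qed
    then show "((\<lambda>x. F (case x of (m, n) \<Rightarrow> (2 * m + n, 2 * n - m))) has_sum b\<^sup>2) UNIV"
      using has_sum_Times_mult[OF \<phi>5 \<phi>5] by (simp add: case_prod_unfold power2_eq_square[of b])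
  qed (auto simp: C_def inj_on_def)
  have shifted: "((\<lambda>x. F (G x)) has_sum w * (c * d)) UNIV"
    if val: "\<And>m n. (fst (G (m, n)))\<^sup>2 + (snd (G (m, n)))\<^sup>2 = 1 + (5 * m\<^sup>2 + 4 * m) + (5 * n\<^sup>2 + 2 * n)"
    for G :: "int \<times> int \<Rightarrow> int \<times> int"
  proof -
    have "F (G (m, n)) = w * (w powi (5 * m\<^sup>2 + 4 * m) * w powi (5 * n\<^sup>2 + 2 * n))" for m n
    proof -
      have "F (G (m, n)) = w powi (1 + (5 * m\<^sup>2 + 4 * m) + (5 * n\<^sup>2 + 2 * n))"
        unfolding val[symmetric] by (simp add: F_def case_prod_unfold)
      then show ?thesis using w by (simp add: power_int_add)
    qed
    then have "(\<lambda>x. F (G x)) = (\<lambda>x. w * (case x of (m, n) \<Rightarrow> w powi (5 * m\<^sup>2 + 4 * m) * w powi (5 * n\<^sup>2 + 2 * n)))"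
      by (simp add: fun_eq_iff split_paired_all)
    then show ?thesis
      using has_sum_cmult_right[OF has_sum_Times_mult[OF f g], of w] by simp
  qed
  \<comment> \<open>Adding 1 to the previous map reaches the class of 1. The other three classes
    arise from this one through multiplication by the units -1, i and -i, whose residues are 4, 2
    and 3; in the last two cases the bound variables are named in the opposite order.\<close>
  have C1: "(F has_sum w * (c * d)) (C 1)"
    by (rule coset[where G = "\<lambda>(m, n). (2 * m + n + 1, 2 * n - m)" and K = "\<lambda>v k. (2 * k - v, k)", OF _ _ _ shifted])
      (auto simp: C_def inj_on_def power2_eq_square algebra_simps)
  have C4: "(F has_sum w * (c * d)) (C 4)"
    by (rule coset[where G = "\<lambda>(m, n). (- (2 * m + n + 1), m - 2 * n)"
          and K = "\<lambda>v k. (v - 2 * k - 2, - k - 1)", OF _ _ _ shifted])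
      (auto simp: C_def inj_on_def power2_eq_square algebra_simps, presburger)
  have C2: "(F has_sum w * (c * d)) (C 2)"
    by (rule coset[where G = "\<lambda>(n, m). (n - 2 * m, 2 * n + m + 1)"
          and K = "\<lambda>v k. (k, v - 1 - 2 * k)", OF _ _ _ shifted])
      (auto simp: C_def inj_on_def power2_eq_square algebra_simps)
  have C3: "(F has_sum w * (c * d)) (C 3)"
    by (rule coset[where G = "\<lambda>(n, m). (2 * m - n, - (2 * n + m + 1))"
          and K = "\<lambda>v k. (- k - 1, 2 * k + 1 - v)", OF _ _ _ shifted])
      (auto simp: C_def inj_on_def power2_eq_square algebra_simps, presburger)
  have "(F has_sum (\<Sum>i\<in>{0,1,2,3,4::int}. if i = 0 then b\<^sup>2 else w * (c * d))) (\<Union>i\<in>{0,1,2,3,4}. C i)"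
    by (rule sum_has_sum) (use C0 C1 C2 C3 C4 in \<open>auto simp: C_def\<close>)
  also have "(\<Union>i\<in>{0,1,2,3,4}. C i) = UNIV"
  proof -
    have "(u + 2 * v) mod 5 \<in> {0,1,2,3,4}" for u v :: int by auto
    then show ?thesis unfolding C_def by blast
  qed
  finally have "(F has_sum (b\<^sup>2 + 4 * w * c * d)) UNIV" by (simp add: mult_ac)
  with total show ?thesis by (rule has_sum_unique)
qed

lemma theta_square_diff_aux:
  fixes P R x y q c d :: complex
  assumes "(P * x\<^sup>2)\<^sup>2 = (R * y\<^sup>2)\<^sup>2 + 4 * - q * (R * c) * (R * d)" "c * d * y = x" "y \<noteq> 0"
  shows "R ^ 2 * y ^ 4 - P ^ 2 * x ^ 4 = 4 * q * R ^ 2 * x / y"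
proof -
  have "R ^ 2 * y ^ 4 - P ^ 2 * x ^ 4 = 4 * q * R ^ 2 * (c * d)"
    using assms(1) by (simp add: algebra_simps eval_nat_numeral)
  also have "c * d = x / y" using assms(2,3) by (simp add: eq_divide_eq)
  finally show ?thesis by simp
qed

text \<open>The dissection at \<open>w = - q\<close>, with its four series turned into products by
  \<open>theta_series\<close>. The product of the theta functions at q and q^3 is (q; q^2) / (q^5;
  q^10), by \<open>qpoch_quintuple\<close>.\<close>

lemma theta_square_diff:
  assumes q: "norm q < 1" "q \<noteq> 0"
  shows "qpoch (q^10) (q^10) ^ 2 * qpoch (q^10) (q^5) ^ 4 - qpoch (q^2) (q^2) ^ 2 * qpoch (q^2) q ^ 4 =
    4 * q * qpoch (q^10) (q^10) ^ 2 * qpoch (q^2) q / qpoch (q^10) (q^5)"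
proof -
  let ?P = "qpoch (q^2) (q^2)" and ?R = "qpoch (q^10) (q^10)"
  let ?x = "qpoch (q^2) q" and ?y = "qpoch (q^10) (q^5)"
  have y0: "?y \<noteq> 0" using q by (intro qpoch_nonzero_norm norm_power_lt_1) auto
  have "((\<lambda>n::int. (- q) powi (n\<^sup>2)) has_sum ?P * ?x\<^sup>2) UNIV"
    using theta_series[OF q, of 1 1] by (simp add: power2_eq_square mult_ac)
  moreover have "((\<lambda>n::int. (- q) powi (5 * n\<^sup>2)) has_sum ?R * ?y\<^sup>2) UNIV"
    using theta_series[OF q, of 5 5] by (simp add: power2_eq_square mult_ac)
  moreover have "((\<lambda>n::int. (- q) powi (5 * n\<^sup>2 + 4 * n)) has_sum ?R * theta (q^10) q) UNIV"
  proof -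
    have "q ^ 10 / q = q ^ 9" using q by (simp add: eval_nat_numeral)
    then show ?thesis using theta_series[OF q, of 9 5] by (simp add: theta_def mult_ac)
  qed
  moreover have "((\<lambda>n::int. (- q) powi (5 * n\<^sup>2 + 2 * n)) has_sum ?R * theta (q^10) (q^3)) UNIV"
  proof -
    have "q ^ 10 / q ^ 3 = q ^ 7" using q by (simp add: eval_nat_numeral)
    then show ?thesis using theta_series[OF q, of 7 5] by (simp add: theta_def mult_ac)
  qed
  ultimately have "(?P * ?x\<^sup>2)\<^sup>2 =
      (?R * ?y\<^sup>2)\<^sup>2 + 4 * - q * (?R * theta (q^10) q) * (?R * theta (q^10) (q^3))"
    using q by (intro theta_square_dissection) auto
  moreover have "theta (q^10) q * theta (q^10) (q^3) * ?y = ?x"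
    by (simp only: qpoch_quintuple(1)[OF q])
  ultimately show ?thesis using y0 by (intro theta_square_diff_aux[of _ _ _ _ q])
qed

section \<open>The generating function of the representation numbers\<close>

lemma has_sum_triangular:
  assumes q: "norm q < 1" "q \<noteq> 0"
  shows "((\<lambda>n::int. q powi (n * (n - 1) div 2)) has_sum 2 * qpoch (q^2) (q^2) / qpoch (q^2) q) UNIV"
proof -
  have nz: "qpoch q q \<noteq> 0" "qpoch (q^2) q \<noteq> 0"
    using q norm_power_lt_1[of q 2] by (simp_all add: qpoch_nonzero_norm)
  \<comment> \<open>The first factor of the symbol is 2; it reflects that \<open>n\<close> and
    \<open>1 - n\<close> give the same triangular number.\<close>
  have 1: "qpoch q (- 1) = 2 * qpoch q (- q)"
    using qpoch_unfold[OF q(1), of "- 1"] by simp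
  have 2: "qpoch q q * qpoch q (- q) = qpoch (q^2) (q^2)"
    by (rule qpoch_neg_mult[OF q(1)])
  have 3: "qpoch q q = qpoch (q^2) q * qpoch (q^2) (q^2)"
    using qpoch_split[OF q(1), of 2 q] by (simp add: numeral_2_eq_2)
  have "qpoch q q * qpoch q (- 1) * qpoch q (- q) = 2 * (qpoch q q * qpoch q (- q))\<^sup>2 / qpoch q q"
    using nz by (simp add: 1 power2_eq_square)
  also have "\<dots> = 2 * qpoch (q^2) (q^2) / qpoch (q^2) q"
    using nz unfolding 2 unfolding 3 by (simp add: power2_eq_square)
  finally show ?thesis
    using jacobi_triple_product[OF q, of 1] by simp
qed

text \<open>One triangular series at q is multiplied by three at q^5, and the quadruples are then
  grouped by the value \<open>N\<close> of the form; each group is finite.\<close>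

lemma has_sum_tri_count:
  assumes q: "norm q < 1" "q \<noteq> 0"
  shows "((\<lambda>n. of_nat (tri_count 1 5 5 5 n) * q ^ n) has_sum
    2 * qpoch (q^2) (q^2) / qpoch (q^2) q * (2 * qpoch (q^10) (q^10) / qpoch (q^10) (q^5)) ^ 3) UNIV"
proof -
  let ?t = "\<lambda>n::int. n * (n - 1) div 2"
  let ?T = "2 * qpoch (q^2) (q^2) / qpoch (q^2) q" and ?T5 = "2 * qpoch (q^10) (q^10) / qpoch (q^10) (q^5)"
  define N where "N = (\<lambda>(x, y, z, w). nat (?t x + 5 * ?t y + 5 * ?t z + 5 * ?t w))"
  note T = has_sum_triangular[OF q]
  have T5: "((\<lambda>n::int. (q^5) powi ?t n) has_sum ?T5) UNIV"
    using has_sum_triangular[OF norm_power_lt_1[OF q(1), of 5]] q by (simp flip: power_mult)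
  have "((\<lambda>(x, y, z, w). q powi ?t x * ((q^5) powi ?t y * ((q^5) powi ?t z * (q^5) powi ?t w))) has_sum
      ?T * (?T5 * (?T5 * ?T5))) UNIV" (is "(?F has_sum _) _")
    using has_sum_Times_mult[OF T has_sum_Times_mult[OF T5 has_sum_Times_mult[OF T5 T5]]]
    by (simp add: case_prod_unfold)
  moreover have "?F = (\<lambda>v. q ^ N v)"
  proof
    fix v :: "int \<times> int \<times> int \<times> int"
    obtain x y z w where v: "v = (x, y, z, w)" by (metis prod_cases4)
    have "int (N v) = ?t x + 5 * ?t y + 5 * ?t z + 5 * ?t w"
      using triangular_nonneg[of x] triangular_nonneg[of y] triangular_nonneg[of z] triangular_nonneg[of w]
      by (simp add: N_def v)
    then have "q ^ N v = q powi (?t x + 5 * ?t y + 5 * ?t z + 5 * ?t w)"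
      by (metis power_int_of_nat)
    moreover have "(q^5) powi k = q powi (5 * k)" for k
      using power_int_mult[of q 5 k] by simp
    ultimately show "?F v = q ^ N v" using q by (simp add: v power_int_add mult_ac)
  qed
  ultimately have "((\<lambda>v. q ^ N v) has_sum ?T * (?T5 * (?T5 * ?T5))) UNIV"
    by (simp only:)
  also have "?this \<longleftrightarrow> ((\<lambda>(n, v). q ^ n) has_sum ?T * (?T5 * (?T5 * ?T5))) (SIGMA n:UNIV. tri_reps 1 5 5 5 n)"
  proof (rule has_sum_reindex_bij_witness[of _ snd "\<lambda>v. (N v, v)"])
    fix a assume "a \<in> (SIGMA n:UNIV. tri_reps 1 5 5 5 n)"
    then obtain n x y z w where "a = (n, x, y, z, w)" "int n = ?t x + 5 * ?t y + 5 * ?t z + 5 * ?t w"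
      by (auto simp: tri_reps_def)
    then show "(N (snd a), snd a) = a" by (simp add: N_def flip: of_nat_eq_iff)
  next
    fix v :: "int \<times> int \<times> int \<times> int"
    obtain x y z w where v: "v = (x, y, z, w)" by (metis prod_cases4)
    show "(N v, v) \<in> (SIGMA n:UNIV. tri_reps 1 5 5 5 n)"
      using triangular_nonneg[of x] triangular_nonneg[of y] triangular_nonneg[of z] triangular_nonneg[of w]
      by (simp add: N_def v tri_reps_def)
  qed auto
  finally have S: "((\<lambda>(n, v). q ^ n) has_sum ?T * (?T5 * (?T5 * ?T5))) (SIGMA n:UNIV. tri_reps 1 5 5 5 n)" .
  have "((\<lambda>n. of_nat (tri_count 1 5 5 5 n) * q ^ n) has_sum ?T * (?T5 * (?T5 * ?T5))) UNIV"
    by (rule has_sum_SigmaD[OF S])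
      (auto intro!: has_sum_finiteI finite_tri_reps simp: tri_count_def)
  then show ?thesis by (simp add: eval_nat_numeral)
qed

lemma eta_quotient_algebra:
  fixes P R x y q :: complex
  assumes nz: "x \<noteq> 0" "y \<noteq> 0" and "R ^ 2 * y ^ 4 - P ^ 2 * x ^ 4 = 4 * q * R ^ 2 * x / y"
  shows "4 * (q * P * R ^ 3 * y ^ 2 / x ^ 2 - q * P ^ 3 * R * x ^ 2 / y ^ 2) = q ^ 2 * (2 * P / x * (2 * R / y) ^ 3)"
proof -
  have "q * P * R ^ 3 * y ^ 2 / x ^ 2 - q * P ^ 3 * R * x ^ 2 / y ^ 2 =
      q * P * R / (x ^ 2 * y ^ 2) * (R ^ 2 * y ^ 4 - P ^ 2 * x ^ 4)"
    using nz by (simp add: field_simps eval_nat_numeral)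
  also have "\<dots> = q * P * R / (x ^ 2 * y ^ 2) * (4 * q * R ^ 2 * x / y)"
    by (simp only: assms)
  finally have "q * P * R ^ 3 * y ^ 2 / x ^ 2 - q * P ^ 3 * R * x ^ 2 / y ^ 2 = \<dots>" .
  then show ?thesis
    using nz by (simp only:) (simp add: field_simps eval_nat_numeral)
qed

text \<open>Both sides are coefficients of power series that agree for all \<open>q\<close> in the
  unit disc. The shift by 2 is the factor q^2 produced by
  \<open>eta_quotient_algebra\<close>.\<close>

theorem tri_count_eq_divisor_coeff:
  "int (tri_count 1 5 5 5 n) = 4 * divisor_coeff (n + 2)"
proof -
  \<comment> \<open>The coefficients of q^2 times the generating function, hence 0 in degrees 0 and
    1.\<close>
  define u where "u m = (if m < 2 then 0 else complex_of_nat (tri_count 1 5 5 5 (m - 2)))" for m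
  define v where "v m = 4 * complex_of_int (divisor_coeff m)" for m
  have v0: "v 0 = 0" by (simp add: v_def divisor_coeff_def)
  have zero: "(\<lambda>m. (u m - v m) * q ^ m) sums 0" if q: "norm q < 1" for q
  proof (cases "q = 0")
    case True
    then show ?thesis using powser_sums_zero[of "\<lambda>m. u m - v m"] v0 by (simp add: u_def)
  next
    case False
    let ?P = "qpoch (q^2) (q^2)" and ?R = "qpoch (q^10) (q^10)"
    let ?x = "qpoch (q^2) q" and ?y = "qpoch (q^10) (q^5)"
    let ?B = "q * ?P * ?R ^ 3 * ?y ^ 2 / ?x ^ 2" and ?A = "q * ?P ^ 3 * ?R * ?x ^ 2 / ?y ^ 2"
    let ?S = "2 * ?P / ?x * (2 * ?R / ?y) ^ 3"
    have nz: "?x \<noteq> 0" "?y \<noteq> 0"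
      using q norm_power_lt_1[OF q] by (simp_all add: qpoch_nonzero_norm)
    have BA: "4 * (?B - ?A) = q ^ 2 * ?S"
      using nz theta_square_diff[OF q False] by (rule eta_quotient_algebra)
    have "((\<lambda>m. of_int (divisor_coeff m) * q ^ m) has_sum (?B - ?A)) {0<..}"
      by (rule has_sum_divisor_coeff[OF q lambert_B_product[OF q False] lambert_A_product[OF q False]])
    from has_sum_cmult_right[OF this, of 4]
    have "((\<lambda>m. v m * q ^ m) has_sum 4 * (?B - ?A)) {0<..}" by (simp add: v_def mult.assoc)
    also have "?this \<longleftrightarrow> ((\<lambda>m. v m * q ^ m) has_sum 4 * (?B - ?A)) UNIV"
      by (rule has_sum_cong_neutral) (auto simp: v0)
    finally have V: "((\<lambda>m. v m * q ^ m) has_sum 4 * (?B - ?A)) UNIV" .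
    have "((\<lambda>n. q ^ 2 * (of_nat (tri_count 1 5 5 5 n) * q ^ n)) has_sum q ^ 2 * ?S) UNIV"
      by (intro has_sum_cmult_right has_sum_tri_count q False)
    also have "?this \<longleftrightarrow> ((\<lambda>m. u m * q ^ m) has_sum q ^ 2 * ?S) {2..}"
      by (rule has_sum_reindex_bij_witness[of _ "\<lambda>m. m - 2" "\<lambda>n. n + 2"]) (auto simp: u_def power_add power2_eq_square)
    also have "\<dots> \<longleftrightarrow> ((\<lambda>m. u m * q ^ m) has_sum q ^ 2 * ?S) UNIV"
      by (rule has_sum_cong_neutral) (auto simp: u_def)
    finally have U: "((\<lambda>m. u m * q ^ m) has_sum q ^ 2 * ?S) UNIV" .
    from sums_diff[OF has_sum_imp_sums[OF U] has_sum_imp_sums[OF V]] show ?thesis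
      unfolding BA by (simp add: left_diff_distrib)
  qed
  have "u m = v m" for m
  proof (cases "m = 0")
    case False
    show ?thesis
    proof (rule ccontr)
      assume "u m \<noteq> v m"
      \<comment> \<open>Isolated zeros: a nonzero coefficient in positive degree would make the sum,
        which is the zero function, nonzero on a punctured disc.\<close>
      then obtain s where "s > 0" "\<And>z::complex. z \<in> cball 0 s - {0} \<Longrightarrow> (0::complex) \<noteq> 0"
        using powser_0_nonzero[of 1 0 "\<lambda>m. u m - v m" "\<lambda>_. 0" m] zero False by auto
      from this(2)[of "of_real s"] \<open>s > 0\<close> show False by auto
    qed
  qed (simp add: v0 u_def)
  from this[of "n + 2"] have "complex_of_int (int (tri_count 1 5 5 5 n)) = complex_of_int (4 * divisor_coeff (n + 2))"
    by (simp add: u_def v_def)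
  then show ?thesis by (simp only: of_int_eq_iff)
qed

section \<open>The character modulo 5 and divisor sums\<close>

lemma chi5_mod: "chi5 (n mod 5) = chi5 n"
  by (simp add: chi5_def)

lemma chi5_mult: "chi5 (a * b) = chi5 a * chi5 b"
proof -
  have five: "k mod 5 \<in> {0, 1, 2, 3, 4}" for k :: nat by auto
  have "chi5 (a mod 5 * (b mod 5)) = chi5 (a mod 5) * chi5 (b mod 5)"
    using five[of a] five[of b] by (elim insertE) (simp_all add: chi5_def)
  then show ?thesis
    using chi5_mod[of "a mod 5 * (b mod 5)"] chi5_mod[of "a * b"] by (simp add: chi5_mod mod_mult_eq)
qed

lemma chi5_power: "chi5 (a ^ k) = chi5 a ^ k"
  by (induction k) (auto simp: chi5_mult, simp add: chi5_def)

lemma Legendre_mod_5: "Legendre (int n) 5 = chi5 n"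
proof -
  have "QuadRes 5 (int n) \<longleftrightarrow> (\<exists>y::int. (y mod 5)^2 mod 5 = int (n mod 5))"
    by (simp add: QuadRes_def unique_euclidean_semiring_class.cong_def power_mod zmod_int)
  also have "\<dots> \<longleftrightarrow> int (n mod 5) \<in> {0, 1, 4}"
  proof
    assume "\<exists>y::int. (y mod 5)^2 mod 5 = int (n mod 5)"
    then obtain y :: int where y: "(y mod 5)^2 mod 5 = int (n mod 5)" by blast
    have "y mod 5 \<in> {0, 1, 2, 3, 4}" by auto
    then show "int (n mod 5) \<in> {0, 1, 4}" unfolding y[symmetric] by (elim insertE) simp_all
  next
    have "(0 mod 5)^2 mod 5 = (0::int)" "(1 mod 5)^2 mod 5 = (1::int)" "(2 mod 5)^2 mod 5 = (4::int)" by simp_all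
    then show "\<exists>y::int. (y mod 5)^2 mod 5 = int (n mod 5)" if "int (n mod 5) \<in> {0, 1, 4}"
      using that by (metis empty_iff insert_iff)
  qed
  finally have Q: "QuadRes 5 (int n) \<longleftrightarrow> int (n mod 5) \<in> {0, 1, 4}" .
  have "[int n = 0] (mod 5) \<longleftrightarrow> n mod 5 = 0" by (simp add: unique_euclidean_semiring_class.cong_def) presburger
  moreover have "n mod 5 \<in> {0, 1, 2, 3, 4}" by auto
  ultimately show ?thesis unfolding Legendre_def Q chi5_def by auto
qed

text \<open>For odd primes other than 5 this is quadratic reciprocity, whose sign is 1 as (5 - 1) /
  2 is even. The values at 2 and 5 are computed.\<close>

lemma kronecker_prime_5:
  assumes "prime p"
  shows "kronecker_prime 5 p = chi5 p"
proof (cases "p = 2 \<or> p = 5")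
  case True
  then show ?thesis
    using Legendre_mod_5[of 5] by (auto simp: kronecker_prime_def chi5_def)
next
  case False
  have p: "2 < p" "p \<noteq> 5" "odd p" "\<not> 5 dvd p"
    using prime_ge_2_nat[OF assms] False prime_odd_nat[OF assms] primes_dvd_imp_eq[of 5 p] assms
    by (auto simp: le_less)
  have "Legendre (int p) 5 * Legendre 5 (int p) = (-1) ^ ((p - 1) div 2 * ((5 - 1) div 2))"
    using Quadratic_Reciprocity[of p 5] assms p by simp
  also have "\<dots> = 1" by simp
  finally have "chi5 p * Legendre 5 (int p) = 1" by (simp add: Legendre_mod_5)
  moreover have "chi5 p * chi5 p = 1"
  proof -
    have "p mod 5 \<in> {0, 1, 2, 3, 4}" "p mod 5 \<noteq> 0" using p by (auto simp: dvd_eq_mod_eq_0)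
    then show ?thesis by (auto simp: chi5_def)
  qed
  ultimately have "Legendre 5 (int p) = chi5 p"
    by (metis mult.assoc mult.commute mult_1)
  then show ?thesis using p by (simp add: kronecker_prime_def)
qed

lemma kronecker_5:
  assumes "m > 0"
  shows "kronecker 5 (int m) = chi5 m"
proof -
  have "chi5 m = chi5 (\<Prod>p\<in>prime_factors m. p ^ multiplicity p m)"
    using prod_prime_factors[of m] assms by simp
  also have "\<dots> = (\<Prod>p\<in>prime_factors m. chi5 p ^ multiplicity p m)"
  proof -
    have "chi5 (\<Prod>p\<in>A. f p) = (\<Prod>p\<in>A. chi5 (f p))" if "finite A" for A :: "nat set" and f
      using that by (induction rule: finite_induct) (auto simp: chi5_mult, simp add: chi5_def)
    then show ?thesis by (simp add: chi5_power)
  qed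
  also have "\<dots> = (\<Prod>p\<in>prime_factors m. kronecker_prime 5 p ^ multiplicity p m)"
    by (intro prod.cong refl) (simp add: kronecker_prime_5 in_prime_factors_imp_prime)
  finally show ?thesis using assms by (simp add: kronecker_def)
qed

lemma chi5_double: "chi5 (2 * n) = - chi5 n" "chi5 (n * 2) = - chi5 n"
  by (simp_all add: chi5_mult) (simp_all add: chi5_def)

lemma chi5_quadruple: "chi5 (4 * n) = chi5 n" "chi5 (n * 4) = chi5 n"
  by (simp_all add: chi5_mult) (simp_all add: chi5_def)

section \<open>Reduction of the alternating divisor sums\<close>

lemma sum_divisors_double:
  fixes f :: "nat \<Rightarrow> int"
  assumes "K > 0"
  shows "(\<Sum>d | d dvd 2 * K. (-1) ^ d * f d) = (\<Sum>d | d dvd K. f (2 * d)) - (\<Sum>d | d dvd 2 * K \<and> odd d. f d)"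
proof -
  \<comment> \<open>Even divisors of \<open>2 * K\<close> are the doubles of the divisors of
    \<open>K\<close> and carry the sign 1; odd divisors carry -1.\<close>
  have "{d. d dvd 2 * K} = (*) 2 ` {d. d dvd K} \<union> {d. d dvd 2 * K \<and> odd d}"
  proof (intro equalityI subsetI)
    fix d assume d: "d \<in> {d. d dvd 2 * K}"
    show "d \<in> (*) 2 ` {d. d dvd K} \<union> {d. d dvd 2 * K \<and> odd d}"
      using d by (cases "even d") (auto elim!: evenE)
  qed auto
  then have "(\<Sum>d | d dvd 2 * K. (-1) ^ d * f d) =
      (\<Sum>d\<in>(*) 2 ` {d. d dvd K}. (-1) ^ d * f d) + (\<Sum>d | d dvd 2 * K \<and> odd d. (-1) ^ d * f d)"
    using assms by (simp only:) (intro sum.union_disjoint, auto)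
  moreover have "(\<Sum>d\<in>(*) 2 ` {d. d dvd K}. (-1) ^ d * f d) = (\<Sum>d | d dvd K. f (2 * d))"
    by (subst sum.reindex) (auto simp: inj_on_def)
  moreover have "(\<Sum>d | d dvd 2 * K \<and> odd d. (-1) ^ d * f d) = - (\<Sum>d | d dvd 2 * K \<and> odd d. f d)"
    unfolding sum_negf[symmetric] by (intro sum.cong) auto
  ultimately show ?thesis by simp
qed

text \<open>A divisor \<open>d\<close> of \<open>4 * m\<close> fails to divide \<open>m\<close>
  exactly if 4 does not divide \<open>4 * m div d\<close>. This cofactor is then twice an odd number
  or odd, and \<open>d\<close> is 2 or 4 times a divisor of \<open>m\<close> with odd
  cofactor.\<close>

lemma divisors_quadruple:
  fixes m :: nat
  assumes "m > 0"
  shows "{d. d dvd 4 * m} - {d. d dvd m} =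
    (*) 2 ` {d. d dvd m \<and> odd (m div d)} \<union> (*) 4 ` {d. d dvd m \<and> odd (m div d)}"
    (is "?L = ?A \<union> ?B")
proof (intro equalityI subsetI)
  fix d assume "d \<in> ?L"
  then obtain e where e: "4 * m = d * e" and nd: "\<not> d dvd m" by (auto elim!: dvdE)
  have d0: "d > 0" using e assms by (auto intro: Nat.gr0I)
  show "d \<in> ?A \<union> ?B"
  proof (cases "even e")
    case True
    then obtain f where f: "e = 2 * f" by blast
    have "odd f"
    proof
      assume "even f"
      then have "m = d * (f div 2)" using e f by auto
      with nd show False by simp
    qed
    moreover have "2 * m = d * f" using e f by simp
    ultimately have "even d" by (metis dvd_triv_left even_mult_iff)
    then obtain d' where d': "d = 2 * d'" by blast
    then have "m = d' * f" using \<open>2 * m = d * f\<close> by simp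
    then have "d' dvd m \<and> odd (m div d')" using \<open>odd f\<close> d' d0 by simp
    then show ?thesis using d' by blast
  next
    case False
    then have "coprime 4 e" using coprime_power_left_iff[of 2 2 e] by simp
    then have "4 dvd d" using e by (metis coprime_dvd_mult_left_iff dvd_triv_left)
    then obtain d' where d': "d = 4 * d'" by blast
    then have "m = d' * e" using e by simp
    then have "d' dvd m \<and> odd (m div d')" using False d' d0 by simp
    then show ?thesis using d' by blast
  qed
next
  fix d assume "d \<in> ?A \<union> ?B"
  then obtain c k where d: "d = k * c" "k = 2 \<or> k = 4" and c: "c dvd m" "odd (m div c)" by auto
  then obtain f where f: "m = c * f" "c > 0" using assms by (auto elim!: dvdE intro: Nat.gr0I)
  then have "odd f" using c by simp
  have "\<not> k * c dvd c * f"
  proof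
    assume "k * c dvd c * f"
    then have "k dvd f" using f by (simp add: mult.commute)
    then show False using d \<open>odd f\<close> by (metis dvd_trans even_numeral)
  qed
  moreover have "k * c dvd 4 * (c * f)"
    using d by (auto simp: mult.assoc intro: mult_dvd_mono)
  ultimately show "d \<in> ?L" using d f by simp
qed

text \<open>The odd divisors contribute equally to both sums, as \<open>chi5 4 = 1\<close>, and
  cancel. Because \<open>chi5 2 = - 1\<close>, an even divisor \<open>2 * d\<close> contributes
  \<open>2 * h d\<close> to either sum, so only the \<open>d\<close> that divide
  \<open>4 * m\<close> but not \<open>m\<close> survive.\<close>

lemma divisor_sum_diff_eq:
  fixes m :: nat
  assumes m: "m > 0"
  shows "(\<Sum>d | d dvd 8 * m. (-1) ^ d * (chi5 d + chi5 ((8 * m) div d)) * int d)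
    - (\<Sum>d | d dvd 2 * m. (-1) ^ d * (chi5 d + chi5 ((2 * m) div d)) * int d) = 4 * divisor_coeff m"
proof -
  define g where "g N d = (chi5 d + chi5 (N div d)) * int d" for N d
  define h where "h d = int d * (chi5 (4 * m div d) - chi5 d)" for d
  define D where "D = {d. d dvd m \<and> odd (m div d)}"
  have fin: "finite {d. d dvd k * m}" if "k > 0" for k using m that by simp
  have split: "(\<Sum>d | d dvd 2 * K. (-1) ^ d * (chi5 d + chi5 (2 * K div d)) * int d) =
      (\<Sum>d | d dvd K. g (2 * K) (2 * d)) - (\<Sum>d | d dvd 2 * K \<and> odd d. g (2 * K) d)" if "K > 0" for K
    using sum_divisors_double[OF that, of "g (2 * K)"] by (simp add: g_def mult.assoc)
  have "(\<Sum>d | d dvd 2 * (4 * m) \<and> odd d. g (2 * (4 * m)) d) = (\<Sum>d | d dvd 2 * m \<and> odd d. g (2 * m) d)"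
  proof (rule sum.cong)
    have "d dvd 2 * (4 * m) \<longleftrightarrow> d dvd 2 * m" if "odd d" for d
    proof -
      have "coprime d 4" using that coprime_power_right_iff[of d 2 2] by simp
      then have "d dvd 4 * (2 * m) \<longleftrightarrow> d dvd 2 * m" by (rule coprime_dvd_mult_right_iff)
      then show ?thesis by simp
    qed
    then show eq: "{d. d dvd 2 * (4 * m) \<and> odd d} = {d. d dvd 2 * m \<and> odd d}" by blast
    fix d assume "d \<in> {d. d dvd 2 * m \<and> odd d}"
    then have "2 * (4 * m) div d = 4 * (2 * m div d)" by (metis (no_types, lifting) div_mult_swap mem_Collect_eq mult.left_commute)
    then show "g (2 * (4 * m)) d = g (2 * m) d" by (simp add: g_def chi5_quadruple)
  qed
  then have "(\<Sum>d | d dvd 8 * m. (-1) ^ d * (chi5 d + chi5 ((8 * m) div d)) * int d)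
    - (\<Sum>d | d dvd 2 * m. (-1) ^ d * (chi5 d + chi5 ((2 * m) div d)) * int d) =
    (\<Sum>d | d dvd 4 * m. g (2 * (4 * m)) (2 * d)) - (\<Sum>d | d dvd m. g (2 * m) (2 * d))"
    using split[of "4 * m"] split[of m] m by simp
  also have "(\<Sum>d | d dvd 4 * m. g (2 * (4 * m)) (2 * d)) = (\<Sum>d | d dvd 4 * m. 2 * h d)"
    by (intro sum.cong refl) (simp add: g_def h_def chi5_double right_diff_distrib left_diff_distrib mult_ac)
  also have "(\<Sum>d | d dvd m. g (2 * m) (2 * d)) = (\<Sum>d | d dvd m. 2 * h d)"
  proof (intro sum.cong refl)
    fix d assume "d \<in> {d. d dvd m}"
    then have "4 * m div d = 4 * (m div d)" by (simp add: div_mult_swap)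
    then show "g (2 * m) (2 * d) = 2 * h d"
      by (simp add: g_def h_def chi5_double chi5_quadruple right_diff_distrib left_diff_distrib)
  qed
  also have "(\<Sum>d | d dvd 4 * m. 2 * h d) - (\<Sum>d | d dvd m. 2 * h d) =
      (\<Sum>d\<in>{d. d dvd 4 * m} - {d. d dvd m}. 2 * h d)"
    using fin[of 4] by (subst sum_diff) auto
  also have "\<dots> = (\<Sum>d\<in>(*) 2 ` D. 2 * h d) + (\<Sum>d\<in>(*) 4 ` D. 2 * h d)"
    unfolding divisors_quadruple[OF m] D_def[symmetric]
  proof (rule sum.union_disjoint)
    show "finite ((*) 2 ` D)" "finite ((*) 4 ` D)" using fin[of 1] by (auto simp: D_def)
    show "(*) 2 ` D \<inter> (*) 4 ` D = {}"
    proof -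
      have False if "a \<in> D" "b \<in> D" "2 * a = 4 * b" for a b
      proof -
        have a: "a = 2 * b" using that by simp
        have "a dvd m" using that by (simp add: D_def)
        then obtain f where f: "m = a * f" by (rule dvdE)
        then have "b > 0" "m = b * (2 * f)" using m a by (auto intro: Nat.gr0I)
        then have "even (m div b)" by simp
        with that show False by (simp add: D_def)
      qed
      then show ?thesis by blast
    qed
  qed
  also have "\<dots> = (\<Sum>d\<in>D. 2 * h (2 * d)) + (\<Sum>d\<in>D. 2 * h (4 * d))"
    by (subst (1 2) sum.reindex) (auto simp: inj_on_def)
  also have "\<dots> = (\<Sum>d\<in>D. 4 * (int d * (chi5 (m div d) - chi5 d)))"
    unfolding sum.distrib[symmetric]
  proof (intro sum.cong refl)
    \<comment> \<open>The doubles contribute with the factor -4, since both characters change sign,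
      and the quadruples with the factor 8.\<close>
    fix d assume "d \<in> D"
    then have "4 * m div (2 * d) = 2 * (m div d)" "4 * m div (4 * d) = m div d"
      by (auto simp: D_def elim!: dvdE)
    then show "2 * h (2 * d) + 2 * h (4 * d) = 4 * (int d * (chi5 (m div d) - chi5 d))"
      by (simp add: h_def chi5_double chi5_quadruple algebra_simps)
  qed
  also have "\<dots> = 4 * divisor_coeff m"
    by (simp add: divisor_coeff_def D_def sum_distrib_left)
  finally show ?thesis .
qed

theorem theorem4p3:
  fixes n :: nat
  assumes "n > 0"
  shows "int (tri_count 1 5 5 5 n) =
    (\<Sum>d | d dvd 8 * n + 16.
       (-1) ^ d * (kronecker 5 (int d) + kronecker 5 (int ((8 * n + 16) div d))) * int d)
    - (\<Sum>d | d dvd 2 * n + 4.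
       (-1) ^ d * (kronecker 5 (int d) + kronecker 5 (int ((2 * n + 4) div d))) * int d)"
proof -
  \<comment> \<open>For positive \<open>N\<close>, divisors and their cofactors are positive, which
    is where \<open>kronecker_5\<close> identifies the symbol with \<open>chi5\<close>.\<close>
  have kron: "(\<Sum>d | d dvd N. (-1) ^ d * (kronecker 5 (int d) + kronecker 5 (int (N div d))) * int d) =
      (\<Sum>d | d dvd N. (-1) ^ d * (chi5 d + chi5 (N div d)) * int d)" if "N > 0" for N :: nat
  proof (intro sum.cong refl)
    fix d assume "d \<in> {d. d dvd N}"
    then have "d > 0" "N div d > 0" using that by (auto elim!: dvdE)
    then show "(-1) ^ d * (kronecker 5 (int d) + kronecker 5 (int (N div d))) * int d =
        (-1) ^ d * (chi5 d + chi5 (N div d)) * int d"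
      by (simp only: kronecker_5)
  qed
  have "8 * n + 16 = 8 * (n + 2)" "2 * n + 4 = 2 * (n + 2)" by simp_all
  then show ?thesis
    using divisor_sum_diff_eq[of "n + 2"] kron[of "8 * n + 16"] kron[of "2 * n + 4"]
    by (simp only: tri_count_eq_divisor_coeff)
qed

end
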